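(* Let $X$ be a centered, nondegenerate, infinitely divisible real random variable with finite variance $V>0$, Gaussian variance $a\ge 0$ and Lévy measure $\nu$ on $\mathbb{R}\setminus\{0\}$, and let $R_X=BY_X$ be its signed canonical remainder. Then for every real $t$, $$K_X(t)=\frac{Vt^2}{2}\,M_{R_X}(t),\qquad M_{R_X}(t)=\mathbb{E}e^{tR_X},$$ where both sides are interpreted by continuity at $t=0$ and the extended value $+\infty$ is allowed away from zero. The law of $R_X$ has an atom of mass $a/V$ at zero, and on the two open half-lines it has the continuous densities $$q_X(r)=\frac{2}{V}\int_{(r,\infty)}(x-r)\,\nu(\mathrm{d}x)\quad (r>0),\qquad q_X(r)=\frac{2}{V}\int_{(-\infty,r)}(r-x)\,\nu(\mathrm{d}x)\quad (r<0).$$ The pair consisting of $V$ and the law of $R_X$ determines $a$, $\nu$, and hence the (centered) law of $X$. More precisely, $\nu=\frac{V}{2}q_X''$ in the sense of distributions on each of the open half-lines $(0,\infty)$ and $(-\infty,0)$.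
   Context: The cumulant generating function of $X$ is $$K_X(t)=\log\mathbb{E}e^{tX}=\frac{at^2}{2}+\int_{\mathbb{R}\setminus\{0\}}(e^{tx}-1-tx)\,\nu(\mathrm{d}x)\in[0,\infty],\qquad t\in\mathbb{R},$$ and $V=a+\int x^2\,\nu(\mathrm{d}x)$. The canonical measure is the finite measure $H_X(\mathrm{d}x)=a\delta_0(\mathrm{d}x)+x^2\nu(\mathrm{d}x)$, of total mass $V$. Let $Y_X$ have the probability law $H_X/V$, let $B\sim\operatorname{Beta}(1,2)$ (density $2(1-b)$ on $(0,1)$) be independent of $Y_X$, and set $R_X=BY_X$ (the signed canonical remainder of $X$). *)

theory Defs
  imports "HOL-Probability.Probability"
begin

section \<open>Infinitely divisible laws\<close>

definition infinitely_divisible :: "real measure \<Rightarrow> bool" where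
  "infinitely_divisible \<mu> \<longleftrightarrow> real_distribution \<mu> \<and>
     (\<forall>n::nat\<ge>1. \<exists>\<rho>. real_distribution \<rho> \<and>
        \<mu> = distr (Pi\<^sub>M {..<n} (\<lambda>_. \<rho>)) borel (\<lambda>x. \<Sum>i<n. x i))"

text \<open>A measure on the punctured line is represented by a Borel measure on the whole line
  that does not charge the origin.\<close>

definition levy_measure :: "real measure \<Rightarrow> bool" where
  "levy_measure \<nu> \<longleftrightarrow> sets \<nu> = sets borel \<and> emeasure \<nu> {0} = 0 \<and>
     (\<integral>\<^sup>+x. ennreal (min 1 (x\<^sup>2)) \<partial>\<nu>) < \<infinity>"

text \<open>The Levy-Khintchine formula with the usual truncation; the drift \<open>b\<close> depends on the
  truncation and is not part of the data.  No moment condition is built in.\<close>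

definition has_gaussian_variance_and_levy_measure ::
    "real measure \<Rightarrow> real \<Rightarrow> real measure \<Rightarrow> bool" where
  "has_gaussian_variance_and_levy_measure \<mu> a \<nu> \<longleftrightarrow> 0 \<le> a \<and> levy_measure \<nu> \<and>
     (\<exists>b::real. \<forall>t. char \<mu> t =
        exp (\<i> * of_real (b * t) - of_real (a * t\<^sup>2 / 2) +
          (CLINT x|\<nu>. iexp (t * x) - 1 - \<i> * of_real (t * x * indicator {-1..1} x))))"

definition centered_infinitely_divisible_rv ::
    "'a measure \<Rightarrow> ('a \<Rightarrow> real) \<Rightarrow> real \<Rightarrow> real \<Rightarrow> real measure \<Rightarrow> bool" where
  "centered_infinitely_divisible_rv M X V a \<nu> \<longleftrightarrow>
     prob_space M \<and> X \<in> borel_measurable M \<and>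
     integrable M (\<lambda>\<omega>. (X \<omega>)\<^sup>2) \<and>
     prob_space.expectation M X = 0 \<and>
     V = prob_space.variance M X \<and> 0 < V \<and>
     infinitely_divisible (distr M borel X) \<and>
     has_gaussian_variance_and_levy_measure (distr M borel X) a \<nu>"


section \<open>Extended moment and cumulant generating functions\<close>

definition mgf :: "'a measure \<Rightarrow> ('a \<Rightarrow> real) \<Rightarrow> real \<Rightarrow> ennreal" where
  "mgf M X t = (\<integral>\<^sup>+\<omega>. ennreal (exp (t * X \<omega>)) \<partial>M)"

definition ln_ennreal :: "ennreal \<Rightarrow> ereal" where
  "ln_ennreal x = (if x = 0 then -\<infinity> else if x = \<infinity> then \<infinity> else ereal (ln (enn2real x)))"

definition cgf :: "'a measure \<Rightarrow> ('a \<Rightarrow> real) \<Rightarrow> real \<Rightarrow> ereal" where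
  "cgf M X t = ln_ennreal (mgf M X t)"


section \<open>The canonical measure and the signed canonical remainder\<close>

definition canonical_measure :: "real \<Rightarrow> real measure \<Rightarrow> real measure" where
  "canonical_measure a \<nu> = measure_of UNIV (sets borel)
     (\<lambda>A. ennreal a * indicator A 0 + (\<integral>\<^sup>+x\<in>A. ennreal (x\<^sup>2) \<partial>\<nu>))"

lemma sets_canonical_measure [simp, measurable_cong]:
  "sets (canonical_measure a \<nu>) = sets borel"
proof -
  have "sets (measure_of UNIV (sets (borel :: real measure)) f) = sets borel"
    for f :: "real set \<Rightarrow> ennreal"
    by (metis sets.sets_measure_of_eq space_borel)
  then show ?thesis by (simp add: canonical_measure_def)
qed

lemma emeasure_canonical_measure:
  assumes \<nu>: "sets \<nu> = sets borel" and A: "A \<in> sets borel"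
  shows "emeasure (canonical_measure a \<nu>) A =
    ennreal a * indicator A 0 + (\<integral>\<^sup>+x\<in>A. ennreal (x\<^sup>2) \<partial>\<nu>)"
proof -
  note [measurable_cong] = \<nu>
  define F where "F = (\<lambda>A::real set. ennreal a * indicator A 0 + (\<integral>\<^sup>+x\<in>A. ennreal (x\<^sup>2) \<partial>\<nu>))"
  define D where "D = density \<nu> (\<lambda>x. ennreal (x\<^sup>2))"
  define G where "G = scale_measure (ennreal a) (return borel (0::real))"
  have F: "F B = emeasure G B + emeasure D B" if "B \<in> sets borel" for B
    using that by (simp add: F_def G_def D_def emeasure_density \<nu>)
  have "countably_additive (sets borel) F"
  proof (rule countably_additiveI)
    fix B :: "nat \<Rightarrow> real set"
    assume B: "range B \<subseteq> sets borel" "disjoint_family B" "(\<Union>i. B i) \<in> sets borel"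
    have Bi: "B i \<in> sets borel" for i using B by auto
    have G: "(\<Sum>i. emeasure G (B i)) = emeasure G (\<Union>i. B i)"
      using B by (intro suminf_emeasure) (auto simp: G_def)
    have D: "(\<Sum>i. emeasure D (B i)) = emeasure D (\<Union>i. B i)"
      using B by (intro suminf_emeasure) (auto simp: D_def \<nu>)
    have "(\<Sum>i. F (B i)) = (\<Sum>i. emeasure G (B i) + emeasure D (B i))"
      using F Bi by simp
    also have "\<dots> = (\<Sum>i. emeasure G (B i)) + (\<Sum>i. emeasure D (B i))"
      by (rule suminf_add [symmetric]) auto
    finally show "(\<Sum>i. F (B i)) = F (\<Union>i. B i)"
      using F B(3) by (simp add: G D)
  qed
  then have "emeasure (canonical_measure a \<nu>) A = F A"
    using A unfolding canonical_measure_def F_def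
    by (intro emeasure_measure_of_sigma)
      (use sets.sigma_algebra_axioms[of "borel::real measure"] in \<open>auto simp: positive_def\<close>)
  then show ?thesis by (simp add: F_def)
qed

text \<open>\<open>R\<close> is a product of independent variables \<open>B\<close>, with the Beta(1,2) density,
  and \<open>Y\<close>, whose law is the normalized canonical measure.\<close>

definition signed_canonical_remainder ::
    "'b measure \<Rightarrow> ('b \<Rightarrow> real) \<Rightarrow> real \<Rightarrow> real \<Rightarrow> real measure \<Rightarrow> bool" where
  "signed_canonical_remainder N R V a \<nu> \<longleftrightarrow>
     prob_space N \<and>
     (\<exists>B Y. prob_space.indep_var N borel B borel Y \<and>
        distributed N lborel B (\<lambda>b. ennreal (2 * (1 - b) * indicator {0<..<1} b)) \<and>
        distr N borel Y = scale_measure (ennreal (1 / V)) (canonical_measure a \<nu>) \<and>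
        R = (\<lambda>\<omega>. B \<omega> * Y \<omega>))"

definition remainder_density :: "real \<Rightarrow> real measure \<Rightarrow> real \<Rightarrow> real" where
  "remainder_density V \<nu> r =
     (if r > 0 then 2 / V * (LINT x:{r<..}|\<nu>. x - r)
      else if r < 0 then 2 / V * (LINT x:{..<r}|\<nu>. r - x)
      else 0)"


section \<open>Distributions on an open subset of the line\<close>

text \<open>Distributions are represented by functionals, to be compared only on the test functions
  of the open set under consideration.\<close>

definition test_functions :: "real set \<Rightarrow> (real \<Rightarrow> real) set" where
  "test_functions S = {\<phi>. (\<forall>n x. (deriv ^^ n) \<phi> field_differentiable at x) \<and>
     (\<exists>K. compact K \<and> K \<subseteq> S \<and> (\<forall>x. x \<notin> K \<longrightarrow> \<phi> x = 0))}"

definition dist_of_fun :: "(real \<Rightarrow> real) \<Rightarrow> (real \<Rightarrow> real) \<Rightarrow> real" where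
  "dist_of_fun f \<phi> = (LINT x|lborel. f x * \<phi> x)"

definition dist_of_measure :: "real measure \<Rightarrow> (real \<Rightarrow> real) \<Rightarrow> real" where
  "dist_of_measure \<mu> \<phi> = (LINT x|\<mu>. \<phi> x)"

definition dist_deriv :: "((real \<Rightarrow> real) \<Rightarrow> real) \<Rightarrow> (real \<Rightarrow> real) \<Rightarrow> real" where
  "dist_deriv T \<phi> = - T (deriv \<phi>)"

end

theory Submission
  imports Defs
begin

text \<open>Normalizing the canonical measure gives a probability law \<open>P\<close>, and \<open>\<nu>\<close> has density
  \<open>V / y\<^sup>2\<close> with respect to \<open>P\<close>.  Everything about the remainder is Fubini for
  \<open>Beta(1,2) \<otimes> P\<close> together with \<open>z\<^sup>2/2 * E exp(zB) = exp z - 1 - z\<close>, valid for complex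
  \<open>z\<close>: real \<open>z\<close> gives the cumulant identity, and imaginary \<open>z\<close> shows that the
  characteristic function of \<open>P\<close> is a second derivative of \<open>t\<^sup>2/2\<close> times that of the
  remainder, whence uniqueness.  For the formula \<open>E exp(tX) = exp(K(t))\<close> in \<open>[0, \<infinity>]\<close>, a
  Gaussian law plus compensated compound Poisson laws with jumps bounded away from \<open>0\<close>
  satisfies it by direct computation and converges weakly to the law of \<open>X\<close> as the small jumps
  are restored.  Testing against \<open>min (exp(tx)) K\<close> gives one inequality at once; the other
  holds because the small-jump factors, having bounded exponential moments of order \<open>2t\<close>, are
  uniformly integrable.\<close>

section \<open>The canonical law\<close>

text \<open>Integrals over \<nu> are phrased through \<open>P\<close> because \<nu> may be infinite
  near the origin: under \<open>P\<close> the factor \<open>V / y\<^sup>2\<close> turns integrands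
  of order x^2 into bounded ones, so Fubini and dominated convergence run over a probability law.
  Division by zero yields zero, so this density also removes the Gaussian atom of \<open>P\<close>
  by itself. The Beta(1,2) identity is Taylor's formula with integral remainder,
  \<open>2 * (1 - b)\<close> being twice its kernel. The moment generating function is the difficult
  part: it may be infinite, and weak convergence controls bounded continuous functions only, so mass
  of \<open>exp (t * x)\<close> could escape in the limit. Jumps of modulus above 1 are therefore
  kept, together with the Gaussian part, in a factor that does not vary; only the small-jump factor
  changes along the approximation. The negative half-line is obtained from the positive one by
  reflection, under which the hypotheses of the locale are stable.\<close>

locale canonical_law =
  fixes V a :: real and \<nu> P :: "real measure"
  assumes V_pos: "0 < V" and a_nonneg: "0 \<le> a"
    and sets_\<nu> [measurable_cong, simp]: "sets \<nu> = sets borel"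
    and \<nu>_zero: "emeasure \<nu> {0} = 0"
    and prob_P: "prob_space P"
    and P_eq: "P = scale_measure (ennreal (1 / V)) (canonical_measure a \<nu>)"
begin

sublocale law: prob_space P by (rule prob_P)

lemma sets_P [measurable_cong, simp]: "sets P = sets borel"
  by (simp add: P_eq)

lemma space_P [simp]: "space P = UNIV"
  using sets_eq_imp_space_eq[OF sets_P] by simp

lemma space_\<nu> [simp]: "space \<nu> = UNIV"
  using sets_eq_imp_space_eq[OF sets_\<nu>] by simp

lemma real_distribution_P: "real_distribution P"
  by unfold_locales simp_all

lemma emeasure_P:
  "A \<in> sets borel \<Longrightarrow> emeasure P A =
     ennreal (1 / V) * (ennreal a * indicator A 0 + (\<integral>\<^sup>+x\<in>A. ennreal (x\<^sup>2) \<partial>\<nu>))"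
  by (simp add: P_eq emeasure_canonical_measure)

lemma AE_\<nu>_nonzero: "AE x in \<nu>. x \<noteq> 0"
  by (rule AE_I[of _ _ "{0}"]) (auto simp: \<nu>_zero)

text \<open>Evaluating \<open>emeasure_P\<close> on \<open>A - {0}\<close> makes the Gaussian term
  vanish; the indicator on the right discards the atom of \<open>P\<close> at the origin, which
  \<nu> does not charge.\<close>

lemma density_\<nu>_square: "density \<nu> (\<lambda>x. ennreal (x\<^sup>2)) = density P (\<lambda>y. ennreal V * indicator (- {0}) y)"
proof (rule measure_eqI)
  fix A assume "A \<in> sets (density \<nu> (\<lambda>x. ennreal (x\<^sup>2)))"
  then have A[measurable]: "A \<in> sets borel" by simp
  have "emeasure (density P (\<lambda>y. ennreal V * indicator (- {0}) y)) A = ennreal V * emeasure P (A - {0})"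
  proof -
    have "(\<integral>\<^sup>+y. (ennreal V * indicator (- {0}) y) * indicator A y \<partial>P) =
        (\<integral>\<^sup>+y. ennreal V * indicator (A - {0}) y \<partial>P)"
      by (intro nn_integral_cong) (auto split: split_indicator)
    then show ?thesis by (simp add: emeasure_density nn_integral_cmult)
  qed
  also have "\<dots> = (ennreal V * ennreal (1 / V)) * (\<integral>\<^sup>+x\<in>A - {0}. ennreal (x\<^sup>2) \<partial>\<nu>)"
    by (simp add: emeasure_P mult.assoc)
  also have "ennreal V * ennreal (1 / V) = 1"
    using V_pos by (simp flip: ennreal_mult)
  also have "1 * (\<integral>\<^sup>+x\<in>A - {0}. ennreal (x\<^sup>2) \<partial>\<nu>) = emeasure (density \<nu> (\<lambda>x. ennreal (x\<^sup>2))) A"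
    by (auto simp: emeasure_density intro!: nn_integral_cong split: split_indicator)
  finally show "emeasure (density \<nu> (\<lambda>x. ennreal (x\<^sup>2))) A =
      emeasure (density P (\<lambda>y. ennreal V * indicator (- {0}) y)) A" by simp
qed simp

text \<open>The density x^2 can be inverted because its only zero is a \<nu>-null set. At
  \<open>y = 0\<close> the value \<open>V / y\<^sup>2\<close> is 0, which absorbs the indicator of
  the preceding lemma.\<close>

lemma \<nu>_density: "\<nu> = density P (\<lambda>y. ennreal (V / y\<^sup>2))"
proof -
  have "\<nu> = density \<nu> (\<lambda>x. ennreal (x\<^sup>2) * ennreal (1 / x\<^sup>2))"
    by (subst density_cong[where f' = "\<lambda>_. 1"])
       (use AE_\<nu>_nonzero in \<open>auto simp: density_1 simp flip: ennreal_mult\<close>)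
  also have "\<dots> = density (density \<nu> (\<lambda>x. ennreal (x\<^sup>2))) (\<lambda>x. ennreal (1 / x\<^sup>2))"
    by (simp add: density_density_eq)
  also have "\<dots> = density P (\<lambda>y. (ennreal V * indicator (- {0}) y) * ennreal (1 / y\<^sup>2))"
    by (simp add: density_\<nu>_square density_density_eq)
  also have "\<dots> = density P (\<lambda>y. ennreal (V / y\<^sup>2))"
    using V_pos by (intro density_cong) (auto split: split_indicator simp flip: ennreal_mult)
  finally show ?thesis .
qed

lemma measure_P_zero: "measure P {0} = a / V"
proof -
  have "(\<integral>\<^sup>+x\<in>{0}. ennreal (x\<^sup>2) \<partial>\<nu>) = 0"
    using AE_\<nu>_nonzero by (subst nn_integral_0_iff_AE) (auto elim!: eventually_mono)
  then have "emeasure P {0} = ennreal (a / V)"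
    using V_pos a_nonneg by (simp add: emeasure_P ennreal_mult[symmetric])
  then show ?thesis
    using V_pos a_nonneg by (simp add: measure_def)
qed

text \<open>Since \<open>y / 0 = 0\<close>, the integrands on the right vanish at the origin.\<close>

lemma nn_integral_\<nu>:
  assumes [measurable]: "f \<in> borel_measurable borel"
  shows "(\<integral>\<^sup>+x. f x \<partial>\<nu>) = (\<integral>\<^sup>+y. ennreal (V / y\<^sup>2) * f y \<partial>P)"
  by (subst \<nu>_density) (simp add: nn_integral_density)

lemma integrable_\<nu>:
  fixes f :: "real \<Rightarrow> 'b::{banach, second_countable_topology}"
  assumes [measurable]: "f \<in> borel_measurable borel"
  shows "integrable \<nu> f \<longleftrightarrow> integrable P (\<lambda>y. (V / y\<^sup>2) *\<^sub>R f y)"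
  using V_pos by (subst \<nu>_density) (simp add: integrable_density)

lemma integral_\<nu>:
  fixes f :: "real \<Rightarrow> 'b::{banach, second_countable_topology}"
  assumes [measurable]: "f \<in> borel_measurable borel"
  shows "(\<integral>x. f x \<partial>\<nu>) = (\<integral>y. (V / y\<^sup>2) *\<^sub>R f y \<partial>P)"
  using V_pos by (subst \<nu>_density) (simp add: integral_density)

text \<open>Passing from \<open>P\<close> back to \<nu> restores the atom at the origin, hence the
  term in \<open>f 0\<close>. Values in [0, \<infinity>] are allowed so that divergent exponential
  moments are covered.\<close>

lemma nn_integral_P:
  assumes [measurable]: "f \<in> borel_measurable borel"
  shows "ennreal V * (\<integral>\<^sup>+y. f y \<partial>P) = ennreal a * f 0 + (\<integral>\<^sup>+x. ennreal (x\<^sup>2) * f x \<partial>\<nu>)"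
proof -
  have "(\<integral>\<^sup>+y. f y \<partial>P) = (\<integral>\<^sup>+y. f 0 * indicator {0} y + f y * indicator (- {0}) y \<partial>P)"
    by (intro nn_integral_cong) (auto split: split_indicator)
  also have "\<dots> = f 0 * emeasure P {0} + (\<integral>\<^sup>+y. f y * indicator (- {0}) y \<partial>P)"
    by (subst nn_integral_add) (auto simp: nn_integral_cmult)
  finally have "ennreal V * (\<integral>\<^sup>+y. f y \<partial>P) =
      (ennreal V * emeasure P {0}) * f 0 + ennreal V * (\<integral>\<^sup>+y. f y * indicator (- {0}) y \<partial>P)"
    by (simp add: distrib_left mult_ac)
  also have "ennreal V * emeasure P {0} = ennreal a"
    using V_pos a_nonneg by (simp add: law.emeasure_eq_measure measure_P_zero flip: ennreal_mult)
  also have "ennreal V * (\<integral>\<^sup>+y. f y * indicator (- {0}) y \<partial>P) = (\<integral>\<^sup>+x. ennreal (x\<^sup>2) * f x \<partial>\<nu>)"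
    using V_pos
    by (auto simp: nn_integral_\<nu> nn_integral_cmult[symmetric] mult.assoc[symmetric] ennreal_mult[symmetric]
        intro!: nn_integral_cong split: split_indicator)
  finally show ?thesis .
qed

text \<open>Under \<open>P\<close> such an integrand becomes bounded by \<open>V * C\<close>,
  whatever the total mass of \<nu>. The integrability claims over \<nu> below rest on this.\<close>

lemma integrable_\<nu>_bounded_square:
  fixes f :: "real \<Rightarrow> 'b::{banach, second_countable_topology}"
  assumes [measurable]: "f \<in> borel_measurable borel" and le: "\<And>x. norm (f x) \<le> C * x\<^sup>2"
  shows "integrable \<nu> f"
proof -
  have C: "0 \<le> C" using order_trans[OF norm_ge_zero le[of 1]] by simp
  have "norm ((V / y\<^sup>2) *\<^sub>R f y) \<le> V * C" for y
    using mult_left_mono[OF le[of y], of "V / y\<^sup>2"] V_pos C by (cases "y = 0") auto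
  then show ?thesis
    by (auto simp: integrable_\<nu> intro!: law.integrable_const_bound[where B="V * C"])
qed

end

definition beta_law :: "real measure" where
  "beta_law = density lborel (\<lambda>b. ennreal (2 * (1 - b) * indicator {0<..<1} b))"

text \<open>The product is realized on a fixed product space, so the law depends on \<open>P\<close>
  alone and uniqueness becomes injectivity of this map.\<close>

definition remainder_law :: "real measure \<Rightarrow> real measure" where
  "remainder_law P = distr (beta_law \<Otimes>\<^sub>M P) borel (\<lambda>(b, y). b * y)"

text \<open>Transfers the given \<open>N\<close>, \<open>B\<close>, \<open>Y\<close> to the model
  \<open>remainder_law P\<close>. That the canonical measure has total mass \<open>V\<close> is also
  read off here: \<open>P\<close> is the law of \<open>Y\<close>, hence a probability law.\<close>

lemma signed_canonical_remainderD:
  assumes R: "signed_canonical_remainder N R V a \<nu>" and "0 < V" "0 \<le> a" "levy_measure \<nu>"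
  defines "P \<equiv> scale_measure (ennreal (1 / V)) (canonical_measure a \<nu>)"
  shows "canonical_law V a \<nu> P" "R \<in> borel_measurable N" "distr N borel R = remainder_law P"
proof -
  obtain B Y where N: "prob_space N" and ind: "prob_space.indep_var N borel B borel Y"
    and B: "distributed N lborel B (\<lambda>b. ennreal (2 * (1 - b) * indicator {0<..<1} b))"
    and Y: "distr N borel Y = P" and R: "R = (\<lambda>\<omega>. B \<omega> * Y \<omega>)"
    using R unfolding signed_canonical_remainder_def P_def by blast
  interpret prob_space N by fact
  have [measurable]: "B \<in> borel_measurable N" "Y \<in> borel_measurable N"
    using indep_var_rv1[OF ind] indep_var_rv2[OF ind] .
  show "canonical_law V a \<nu> P"
    using \<open>levy_measure \<nu>\<close> \<open>0 < V\<close> \<open>0 \<le> a\<close> prob_space_distr[of Y borel]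
    unfolding canonical_law_def levy_measure_def Y by (simp add: P_def)
  show "R \<in> borel_measurable N" unfolding R by measurable
  have "distr N borel B = beta_law"
    using distributed_distr_eq_density[OF B] by (simp add: beta_law_def cong: distr_cong)
  moreover have "distr N borel B \<Otimes>\<^sub>M distr N borel Y = distr N (borel \<Otimes>\<^sub>M borel) (\<lambda>x. (B x, Y x))"
    using ind unfolding indep_var_distribution_eq by blast
  ultimately show "distr N borel R = remainder_law P"
    by (simp add: remainder_law_def Y[symmetric] distr_distr R o_def)
qed

section \<open>The law of the remainder\<close>

lemma sets_beta_law [measurable_cong, simp]: "sets beta_law = sets borel"
  by (simp add: beta_law_def)

lemma space_beta_law [simp]: "space beta_law = UNIV"
  by (simp add: beta_law_def)

lemma nn_integral_beta_law:
  assumes [measurable]: "f \<in> borel_measurable borel"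
  shows "(\<integral>\<^sup>+b. f b \<partial>beta_law) = (\<integral>\<^sup>+b. ennreal (2 * (1 - b) * indicator {0<..<1} b) * f b \<partial>lborel)"
  by (simp add: beta_law_def nn_integral_density)

lemma prob_space_beta_law: "prob_space beta_law"
proof
  have "emeasure beta_law (space beta_law) =
      (\<integral>\<^sup>+b. ennreal (2 * (1 - b)) * indicator {0..1} b \<partial>lborel)"
  proof -
    have "AE b in lborel. ennreal (2 * (1 - b) * indicator {0<..<1} b) =
        ennreal (2 * (1 - b)) * indicator {0..1} (b :: real)"
      using AE_lborel_singleton[of 0] AE_lborel_singleton[of 1]
      by eventually_elim (auto split: split_indicator)
    then show ?thesis
      by (simp add: beta_law_def emeasure_density nn_integral_cong_AE del: right_diff_distrib_numeral)
  qed
  also have "\<dots> = 1"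
    by (subst nn_integral_FTC_Icc[where F = "\<lambda>b. 2 * b - b\<^sup>2"])
       (auto intro!: derivative_eq_intros)
  finally show "emeasure beta_law (space beta_law) = 1" .
qed

interpretation beta_law: prob_space beta_law
  by (rule prob_space_beta_law)

lemma measure_beta_law_UNIV [simp]: "measure beta_law UNIV = 1"
  using beta_law.prob_space by simp

lemma AE_beta_law: "AE b in beta_law. 0 < b \<and> b < 1"
  unfolding beta_law_def by (subst AE_density) (auto intro!: AE_I2 split: split_indicator)

text \<open>Taylor's formula with integral remainder. With \<open>z\<^sup>2\<close> kept under the
  integral the integrand has the primitive
  \<open>2 * ((1 - b) * z * exp (z * b) + exp (z * b))\<close>, so there is no division by
  \<open>z\<close> and \<open>z = 0\<close> is included.\<close>

lemma integral_exp_beta_law: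
  fixes z :: complex
  shows "z\<^sup>2 * (CLINT b|beta_law. exp (z * of_real b)) = 2 * (exp z - 1 - z)"
proof -
  have "z\<^sup>2 * (CLINT b|beta_law. exp (z * of_real b)) =
      z\<^sup>2 * (CLINT b|lborel. (2 * (1 - b) * indicator {0<..<1} b) *\<^sub>R exp (z * of_real b))"
    unfolding beta_law_def by (subst integral_density) (auto split: split_indicator)
  also have "\<dots> = (CLINT b|lborel. z\<^sup>2 * ((2 * (1 - b) * indicator {0<..<1} b) *\<^sub>R exp (z * of_real b)))"
    by (simp only: integral_mult_right_zero)
  also have "\<dots> = (CLINT b|lborel. indicator {0..1} b *\<^sub>R (z\<^sup>2 * (2 * (1 - of_real b) * exp (z * of_real b))))"
  proof (rule integral_cong_AE)
    show "AE b in lborel. z\<^sup>2 * ((2 * (1 - b) * indicator {0<..<1} b) *\<^sub>R exp (z * of_real b)) =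
        indicator {0..1} b *\<^sub>R (z\<^sup>2 * (2 * (1 - of_real b) * exp (z * of_real b)))"
      using AE_lborel_singleton[of 0] AE_lborel_singleton[of 1]
      by eventually_elim (auto split: split_indicator simp: scaleR_conv_of_real)
  qed simp_all
  also have "\<dots> = 2 * ((1 - of_real 1) * z * exp (z * of_real 1) + exp (z * of_real 1))
      - 2 * ((1 - of_real 0) * z * exp (z * of_real 0) + exp (z * of_real 0))"
  proof (rule integral_FTC_Icc)
    fix x :: real
    have "((\<lambda>w. 2 * ((1 - w) * z * exp (z * w) + exp (z * w))) has_field_derivative
        z\<^sup>2 * (2 * (1 - of_real x) * exp (z * of_real x))) (at (of_real x))"
      by (auto intro!: derivative_eq_intros simp: algebra_simps power2_eq_square)
    from has_vector_derivative_real_field[OF this]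
    show "((\<lambda>b. 2 * ((1 - of_real b) * z * exp (z * of_real b) + exp (z * of_real b))) has_vector_derivative
        z\<^sup>2 * (2 * (1 - of_real x) * exp (z * of_real x))) (at x within {0..1})"
      by (simp add: has_vector_derivative_at_within)
  qed (auto intro!: continuous_intros)
  also have "\<dots> = 2 * (exp z - 1 - z)"
    by (simp add: algebra_simps)
  finally show ?thesis .
qed

lemma nn_integral_exp_beta_law:
  fixes z :: real
  shows "ennreal (z\<^sup>2 / 2) * (\<integral>\<^sup>+b. ennreal (exp (b * z)) \<partial>beta_law) = ennreal (exp z - 1 - z)"
proof -
  have "AE b in beta_law. norm (exp (b * z)) \<le> exp \<bar>z\<bar>"
    using AE_beta_law
  proof eventually_elim
    case (elim b)
    have "b * z \<le> 1 * \<bar>z\<bar>"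
      by (rule order_trans[OF abs_ge_self]) (use elim in \<open> simp add: abs_mult mult_left_le_one_le\<close>)
    then show ?case by simp
  qed
  then have "integrable beta_law (\<lambda>b. exp (b * z))"
    by (intro beta_law.integrable_const_bound[where B="exp \<bar>z\<bar>"]) auto
  then have "(\<integral>\<^sup>+b. ennreal (exp (b * z)) \<partial>beta_law) = ennreal (\<integral>b. exp (b * z) \<partial>beta_law)"
    by (intro nn_integral_eq_integral) auto
  moreover have "z\<^sup>2 * (\<integral>b. exp (b * z) \<partial>beta_law) = 2 * (exp z - 1 - z)"
  proof -
    have "(CLINT b|beta_law. exp (of_real z * of_real b)) = of_real (\<integral>b. exp (b * z) \<partial>beta_law)"
      by (subst integral_complex_of_real[symmetric])
         (simp add: exp_of_real[symmetric] mult.commute)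
    then have "of_real (z\<^sup>2 * (\<integral>b. exp (b * z) \<partial>beta_law)) = (of_real (2 * (exp z - 1 - z)) :: complex)"
      using integral_exp_beta_law[of "of_real z"]
      by (simp add: exp_of_real)
    then show ?thesis by (simp only: of_real_eq_iff)
  qed
  ultimately show ?thesis
    by (simp add: field_simps flip: ennreal_mult')
qed

text \<open>The substitution \<open>r = b * y\<close> shows that for positive \<open>y\<close> the
  variable \<open>B * y\<close> has density \<open>2 * (y - r) / y\<^sup>2\<close> between 0 and
  \<open>y\<close>; the maximum encodes the cutoff at \<open>y\<close>. For \<open>y \<le> 0\<close>
  both sides vanish, as \<open>A\<close> lies in the positive half-line.\<close>

lemma nn_integral_indicator_beta_law:
  assumes [measurable]: "A \<in> sets borel" and A: "A \<subseteq> {0<..}"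
  shows "(\<integral>\<^sup>+b. indicator A (b * y) \<partial>beta_law) =
    (\<integral>\<^sup>+r. ennreal (2 * max 0 (y - r) / y\<^sup>2) * indicator A r \<partial>lborel)"
proof (cases "0 < y")
  case True
  have "(\<integral>\<^sup>+r. ennreal (2 * max 0 (y - r) / y\<^sup>2) * indicator A r \<partial>lborel)
      = ennreal y * (\<integral>\<^sup>+b. ennreal (2 * max 0 (y - y * b) / y\<^sup>2) * indicator A (y * b) \<partial>lborel)"
    using True nn_integral_real_affine[of "\<lambda>r. ennreal (2 * max 0 (y - r) / y\<^sup>2) * indicator A r" y 0] by simp
  also have "\<dots> = (\<integral>\<^sup>+b. ennreal (2 * (1 - b) * indicator {0<..<1} b) * indicator A (b * y) \<partial>lborel)"
  proof (subst nn_integral_cmult[symmetric], simp, intro nn_integral_cong)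
    fix b
    show "ennreal y * (ennreal (2 * max 0 (y - y * b) / y\<^sup>2) * indicator A (y * b)) =
        ennreal (2 * (1 - b) * indicator {0<..<1} b) * indicator A (b * y)"
    proof (cases "y * b \<in> A")
      case yb: True
      then have b: "0 < b" using A True by (auto simp: zero_less_mult_iff)
      have "y - y * b = y * (1 - b)" by (simp add: algebra_simps)
      then have "y * (2 * max 0 (y - y * b) / y\<^sup>2) = 2 * (1 - b) * indicator {0<..<1} b"
        using True b by (auto simp: power2_eq_square max_def mult_le_0_iff zero_le_mult_iff split: split_indicator)
      then show ?thesis using yb True by (simp add: mult.commute flip: ennreal_mult)
    qed (simp add: mult.commute)
  qed
  finally show ?thesis by (simp add: nn_integral_beta_law)
next
  case False
  have "(\<integral>\<^sup>+b. indicator A (b * y) \<partial>beta_law) = (\<integral>\<^sup>+b. 0 \<partial>beta_law)"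
    using AE_beta_law
    by (intro nn_integral_cong_AE, eventually_elim)
       (use A False in \<open>auto simp: indicator_def zero_less_mult_iff\<close>)
  moreover have "(\<integral>\<^sup>+r. ennreal (2 * max 0 (y - r) / y\<^sup>2) * indicator A r \<partial>lborel) = (\<integral>\<^sup>+r. 0 \<partial>(lborel :: real measure))"
    using A False by (intro nn_integral_cong) (auto simp: indicator_def)
  ultimately show ?thesis by simp
qed

context canonical_law
begin

sublocale joint: pair_prob_space beta_law P ..

lemma nn_integral_remainder_law:
  assumes [measurable]: "f \<in> borel_measurable borel"
  shows "(\<integral>\<^sup>+r. f r \<partial>remainder_law P) = (\<integral>\<^sup>+y. \<integral>\<^sup>+b. f (b * y) \<partial>beta_law \<partial>P)"
proof -
  have "(\<lambda>(b, y). b * y :: real) \<in> borel_measurable (beta_law \<Otimes>\<^sub>M P)" by measurable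
  then have "(\<integral>\<^sup>+r. f r \<partial>remainder_law P) = (\<integral>\<^sup>+p. (case p of (b, y) \<Rightarrow> f (b * y)) \<partial>(beta_law \<Otimes>\<^sub>M P))"
    by (simp add: remainder_law_def nn_integral_distr case_prod_unfold)
  also have "\<dots> = (\<integral>\<^sup>+y. \<integral>\<^sup>+b. f (b * y) \<partial>beta_law \<partial>P)"
    by (subst joint.nn_integral_snd[symmetric]) auto
  finally show ?thesis .
qed

lemma sets_remainder_law [simp, measurable_cong]: "sets (remainder_law P) = sets borel"
  by (simp add: remainder_law_def)

lemma emeasure_remainder_law:
  assumes [measurable]: "A \<in> sets borel"
  shows "emeasure (remainder_law P) A = (\<integral>\<^sup>+y. \<integral>\<^sup>+b. indicator A (b * y) \<partial>beta_law \<partial>P)"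
  using nn_integral_remainder_law[of "indicator A"] by simp

text \<open>\<open>B\<close> is almost surely nonzero, so the product vanishes exactly when
  \<open>Y\<close> does.\<close>

lemma measure_remainder_law_zero: "measure (remainder_law P) {0} = a / V"
proof -
  have "emeasure (remainder_law P) {0} = (\<integral>\<^sup>+y. indicator {0} y \<partial>P)"
    unfolding emeasure_remainder_law[OF borel_singleton[OF sets.empty_sets]]
  proof (intro nn_integral_cong)
    fix y
    have "(\<integral>\<^sup>+b. indicator {0} (b * y) \<partial>beta_law) = (\<integral>\<^sup>+b. indicator {0} y \<partial>beta_law)"
      using AE_beta_law by (intro nn_integral_cong_AE, eventually_elim) (auto simp: indicator_def)
    then show "(\<integral>\<^sup>+b. indicator {0} (b * y) \<partial>beta_law) = (indicator {0} y :: ennreal)"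
      using beta_law.emeasure_space_1 by simp
  qed
  then show ?thesis
    using measure_P_zero by (simp add: measure_def)
qed

text \<open>\<open>m y\<close> is the moment generating function of \<open>B * y\<close>. Its value
  1 at \<open>y = 0\<close> turns the atom of \<open>P\<close> into the Gaussian term, and
  \<open>nn_integral_exp_beta_law\<close> with \<open>z = t * x\<close> turns the rest into the
  cumulant integrand. All integrals are taken in [0, \<infinity>], so both sides may be
  infinite.\<close>

lemma mgf_remainder_law:
  "ennreal (V * t\<^sup>2 / 2) * (\<integral>\<^sup>+r. ennreal (exp (t * r)) \<partial>remainder_law P) =
    ennreal (a * t\<^sup>2 / 2) + (\<integral>\<^sup>+x. ennreal (exp (t * x) - 1 - t * x) \<partial>\<nu>)"
proof -
  define m where "m y = (\<integral>\<^sup>+b. ennreal (exp (t * (b * y))) \<partial>beta_law)" for y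
  have [measurable]: "m \<in> borel_measurable borel" unfolding m_def by measurable
  have "ennreal (V * t\<^sup>2 / 2) * (\<integral>\<^sup>+r. ennreal (exp (t * r)) \<partial>remainder_law P)
      = ennreal (t\<^sup>2 / 2) * (ennreal V * (\<integral>\<^sup>+y. m y \<partial>P))"
  proof -
    have "ennreal (V * t\<^sup>2 / 2) = ennreal (t\<^sup>2 / 2) * ennreal V"
      using V_pos by (simp add: mult.commute flip: ennreal_mult)
    then show ?thesis
      by (simp add: nn_integral_remainder_law m_def mult.assoc)
  qed
  also have "\<dots> = ennreal (t\<^sup>2 / 2) * (ennreal a * m 0) + ennreal (t\<^sup>2 / 2) * (\<integral>\<^sup>+x. ennreal (x\<^sup>2) * m x \<partial>\<nu>)"
    by (simp add: nn_integral_P distrib_left)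
  also have "m 0 = 1"
    using beta_law.emeasure_space_1 by (simp add: m_def)
  also have "ennreal (t\<^sup>2 / 2) * (ennreal a * 1) = ennreal (a * t\<^sup>2 / 2)"
    using a_nonneg by (simp add: mult.commute flip: ennreal_mult)
  also have "ennreal (t\<^sup>2 / 2) * (\<integral>\<^sup>+x. ennreal (x\<^sup>2) * m x \<partial>\<nu>) =
      (\<integral>\<^sup>+x. ennreal ((t * x)\<^sup>2 / 2) * m x \<partial>\<nu>)"
    by (subst nn_integral_cmult[symmetric])
       (auto simp: mult.assoc[symmetric] power_mult_distrib simp flip: ennreal_mult intro!: nn_integral_cong)
  also have "\<dots> = (\<integral>\<^sup>+x. ennreal (exp (t * x) - 1 - t * x) \<partial>\<nu>)"
    by (intro nn_integral_cong, subst nn_integral_exp_beta_law[symmetric]) (simp add: m_def mult_ac)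
  finally show ?thesis .
qed

lemma char_remainder_law: "char (remainder_law P) t = (CLINT y|P. CLINT b|beta_law. iexp (t * (b * y)))"
proof -
  have "char (remainder_law P) t = (CLINT p|(beta_law \<Otimes>\<^sub>M P). (case p of (b, y) \<Rightarrow> iexp (t * (b * y))))"
    unfolding char_def remainder_law_def by (subst integral_distr) (auto simp: case_prod_unfold)
  also have "\<dots> = (CLINT y|P. CLINT b|beta_law. iexp (t * (b * y)))"
    by (subst joint.integral_snd) (auto intro!: joint.P.integrable_const_bound[where B=1])
  finally show ?thesis .
qed

end

section \<open>Densities on the half-lines\<close>

context canonical_law
begin

lemma set_integrable_pos:
  assumes "0 < r" shows "set_integrable \<nu> {r<..} (\<lambda>x. x - r)"
  unfolding set_integrable_def
proof (rule integrable_\<nu>_bounded_square)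
  fix x
  have "x - r \<le> 1 / r * x\<^sup>2" if "r < x"
  proof -
    have "r * x \<le> x * x" using that assms by (intro mult_right_mono) auto
    then have "x \<le> 1 / r * x\<^sup>2" using assms by (simp add: field_simps power2_eq_square)
    then show ?thesis using assms by simp
  qed
  then show "norm (indicator {r<..} x *\<^sub>R (x - r)) \<le> 1 / r * x\<^sup>2"
    using assms by (auto split: split_indicator)
qed measurable

text \<open>Uniform in \<open>r \<ge> c\<close>: this later dominates the kernel on the whole
  support of a test function.\<close>

lemma tail_kernel_le:
  fixes c r y :: real
  assumes "0 < c" "c \<le> r" shows "max 0 (y - r) / y\<^sup>2 \<le> 1 / c"
proof (cases "r < y")
  case True
  have "c * (y - r) \<le> y * y" using True assms by (intro mult_mono) auto
  then show ?thesis using True assms by (simp add: field_simps power2_eq_square)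
qed (use assms in auto)

lemma integrable_tail_kernel:
  assumes "0 < r" shows "integrable P (\<lambda>y. 2 * max 0 (y - r) / y\<^sup>2)"
proof (rule law.integrable_const_bound[where B = "2 * (1 / r)"])
  have "norm (2 * max 0 (y - r) / y\<^sup>2) \<le> 2 * (1 / r)" for y
    using mult_left_mono[OF tail_kernel_le[OF assms order_refl, of y], of 2] by simp
  then show "AE y in P. norm (2 * max 0 (y - r) / y\<^sup>2) \<le> 2 * (1 / r)" by simp
qed simp

lemma remainder_density_pos:
  assumes "0 < r" shows "remainder_density V \<nu> r = (\<integral>y. 2 * max 0 (y - r) / y\<^sup>2 \<partial>P)"
proof -
  have "remainder_density V \<nu> r = 2 / V * (\<integral>y. (V / y\<^sup>2) * (indicator {r<..} y * (y - r)) \<partial>P)"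
    using assms by (simp add: remainder_density_def set_lebesgue_integral_def integral_\<nu>)
  also have "\<dots> = (\<integral>y. 2 / V * ((V / y\<^sup>2) * (indicator {r<..} y * (y - r))) \<partial>P)"
    by (simp only: integral_mult_right_zero)
  also have "\<dots> = (\<integral>y. 2 * max 0 (y - r) / y\<^sup>2 \<partial>P)"
    using V_pos by (intro Bochner_Integration.integral_cong) (auto split: split_indicator simp: max_def)
  finally show ?thesis .
qed

text \<open>Each kernel \<open>2 * max 0 (y - r) / y\<^sup>2\<close> is convex in \<open>r\<close>,
  hence so is its average over \<open>P\<close>, and a finite convex function on an open interval is
  continuous.\<close>

lemma continuous_on_remainder_density_pos: "continuous_on {0<..} (remainder_density V \<nu>)"
proof (rule convex_on_continuous)
  show "convex_on {0<..} (remainder_density V \<nu>)"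
  proof (rule convex_onI)
    fix t x y :: real
    assume t: "0 < t" "t < 1" and x: "x \<in> {0<..}" and y: "y \<in> {0<..}"
    define k where "k r z = 2 * max 0 (z - r) / z\<^sup>2" for r z :: real
    have pos: "0 < (1 - t) * x + t * y" using t x y by (intro add_pos_pos) auto
    have int: "integrable P (k r)" if "0 < r" for r
      unfolding k_def using integrable_tail_kernel[OF that] .
    have "k ((1 - t) * x + t * y) z \<le> (1 - t) * k x z + t * k y z" for z
    proof -
      have "z - ((1 - t) * x + t * y) = (1 - t) * (z - x) + t * (z - y)" by (simp add: algebra_simps)
      also have "\<dots> \<le> (1 - t) * max 0 (z - x) + t * max 0 (z - y)"
        using t by (intro add_mono mult_left_mono) auto
      finally have "max 0 (z - ((1 - t) * x + t * y)) \<le> (1 - t) * max 0 (z - x) + t * max 0 (z - y)"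
        using t by simp
      then have "max 0 (z - ((1 - t) * x + t * y)) * (2 / z\<^sup>2) \<le>
          ((1 - t) * max 0 (z - x) + t * max 0 (z - y)) * (2 / z\<^sup>2)"
        by (rule mult_right_mono) simp
      moreover have "k r z = max 0 (z - r) * (2 / z\<^sup>2)" for r
        by (simp add: k_def)
      ultimately show ?thesis by (simp only: distrib_right mult.assoc)
    qed
    then have "(\<integral>z. k ((1 - t) * x + t * y) z \<partial>P) \<le> (\<integral>z. (1 - t) * k x z + t * k y z \<partial>P)"
      using int pos x y by (intro integral_mono) auto
    also have "\<dots> = (1 - t) * (\<integral>z. k x z \<partial>P) + t * (\<integral>z. k y z \<partial>P)"
      using int x y by simp
    finally show "remainder_density V \<nu> ((1 - t) *\<^sub>R x + t *\<^sub>R y) \<le>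
        (1 - t) * remainder_density V \<nu> x + t * remainder_density V \<nu> y"
      using pos x y by (simp add: remainder_density_pos k_def)
  qed simp
qed simp

text \<open>Conditionally on \<open>Y = y\<close> the remainder has the kernel of
  \<open>nn_integral_indicator_beta_law\<close> as density; Fubini averages it over
  \<open>P\<close>.\<close>

lemma emeasure_remainder_law_pos:
  assumes [measurable]: "A \<in> sets borel" and A: "A \<subseteq> {0<..}"
  shows "emeasure (remainder_law P) A = (\<integral>\<^sup>+r\<in>A. ennreal (remainder_density V \<nu> r) \<partial>lborel)"
proof -
  interpret lp: pair_sigma_finite lborel P ..
  have "emeasure (remainder_law P) A =
      (\<integral>\<^sup>+y. \<integral>\<^sup>+r. ennreal (2 * max 0 (y - r) / y\<^sup>2) * indicator A r \<partial>lborel \<partial>P)"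
    by (simp add: emeasure_remainder_law nn_integral_indicator_beta_law A)
  also have "\<dots> = (\<integral>\<^sup>+r. \<integral>\<^sup>+y. ennreal (2 * max 0 (y - r) / y\<^sup>2) * indicator A r \<partial>P \<partial>lborel)"
    by (rule lp.Fubini') measurable
  also have "\<dots> = (\<integral>\<^sup>+r. ennreal (remainder_density V \<nu> r) * indicator A r \<partial>lborel)"
  proof (intro nn_integral_cong)
    fix r :: real
    show "(\<integral>\<^sup>+y. ennreal (2 * max 0 (y - r) / y\<^sup>2) * indicator A r \<partial>P) =
        ennreal (remainder_density V \<nu> r) * indicator A r"
    proof (cases "r \<in> A")
      case True
      then have "0 < r" using A by auto
      then show ?thesis
        using True by (simp add: remainder_density_pos nn_integral_eq_integral integrable_tail_kernel)
    qed simp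
  qed
  finally show ?thesis .
qed

text \<open>The kernel \<open>max 0 (y - r)\<close> is a fundamental solution of the second
  derivative, so integrating it against \<open>\<phi>''\<close> in \<open>r\<close> gives back
  \<open>\<phi> y\<close>; Fubini does the rest. The gap \<open>c > 0\<close> bounds the kernel on
  the support and makes the double integral absolutely convergent.\<close>

lemma integral_test_function_pos:
  fixes \<phi> \<phi>' \<phi>'' :: "real \<Rightarrow> real"
  assumes \<phi>: "\<And>x. (\<phi> has_field_derivative \<phi>' x) (at x)"
    and \<phi>': "\<And>x. (\<phi>' has_field_derivative \<phi>'' x) (at x)"
    and \<phi>'': "continuous_on UNIV \<phi>''"
    and c: "0 < c" and supp: "\<And>x. x \<notin> {c..d} \<Longrightarrow> \<phi> x = 0"
  shows "(\<integral>x. \<phi> x \<partial>\<nu>) = V / 2 * (\<integral>r. remainder_density V \<nu> r * \<phi>'' r \<partial>lborel)"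
proof -
  interpret lp: pair_sigma_finite lborel P ..
  have meas[measurable]: "\<phi> \<in> borel_measurable borel" "\<phi>'' \<in> borel_measurable borel"
    using \<phi>'' \<phi> by (auto intro!: borel_measurable_continuous_onI continuous_at_imp_continuous_on DERIV_isCont)
  \<comment> \<open>The complement of the interval is open, so vanishing there passes to the
    derivatives.\<close>
  have op: "open (- {c..d})" by (simp add: open_Compl)
  have supp': "\<phi>' x = 0" if "x \<notin> {c..d}" for x
  proof (rule DERIV_unique[OF \<phi>])
    show "(\<phi> has_field_derivative 0) (at x)"
      by (rule has_field_derivative_transform_within_open[where f = "\<lambda>_. 0" and S = "- {c..d}"])
         (use op that supp in auto)
  qed
  have supp'': "\<phi>'' x = 0" if "x \<notin> {c..d}" for x
  proof (rule DERIV_unique[OF \<phi>'])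
    show "(\<phi>' has_field_derivative 0) (at x)"
      by (rule has_field_derivative_transform_within_open[where f = "\<lambda>_. 0" and S = "- {c..d}"])
         (use op that supp' in auto)
  qed
  define h where "h r y = 2 * max 0 (y - r) / y\<^sup>2 * \<phi>'' r" for r y
  have [measurable]: "case_prod h \<in> borel_measurable (lborel \<Otimes>\<^sub>M P)"
    unfolding h_def by measurable
  obtain B where B: "\<And>r. r \<in> {c..d} \<Longrightarrow> norm (\<phi>'' r) \<le> B"
  proof -
    have "bounded (\<phi>'' ` {c..d})"
      by (intro compact_imp_bounded compact_continuous_image continuous_on_subset[OF \<phi>'']) auto
    then obtain b where "\<forall>x\<in>{c..d}. norm (\<phi>'' x) \<le> b"
      unfolding bounded_iff by auto
    then show ?thesis by (intro that[of b]) blast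
  qed
  have h_bound: "norm (h r y) \<le> 2 / c * B" if r: "r \<in> {c..d}" for r y
  proof -
    have "norm (h r y) = (2 * (max 0 (y - r) / y\<^sup>2)) * norm (\<phi>'' r)"
      by (simp add: h_def abs_mult)
    also have "\<dots> \<le> (2 * (1 / c)) * B"
      using r c B[OF r] tail_kernel_le[of c r y] by (intro mult_mono) auto
    finally show ?thesis by simp
  qed
  have int: "integrable (lborel \<Otimes>\<^sub>M P) (case_prod h)"
  proof (rule integrableI_bounded_set[where A = "{c..d} \<times> UNIV" and B = "2 / c * B"])
    show "{c..d} \<times> UNIV \<in> sets (lborel \<Otimes>\<^sub>M P)"
      by (intro pair_measureI) auto
    show "emeasure (lborel \<Otimes>\<^sub>M P) ({c..d} \<times> UNIV) < \<infinity>"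
      using law.emeasure_space_1
      by (subst law.emeasure_pair_measure_Times) (auto simp: emeasure_lborel_Icc_eq)
    show "AE x in lborel \<Otimes>\<^sub>M P. x \<in> {c..d} \<times> UNIV \<longrightarrow> norm (case_prod h x) \<le> 2 / c * B"
      using h_bound by (intro AE_I2) auto
    show "AE x in lborel \<Otimes>\<^sub>M P. x \<notin> {c..d} \<times> UNIV \<longrightarrow> case_prod h x = 0"
    proof (intro AE_I2 impI)
      fix x :: "real \<times> real" assume "x \<notin> {c..d} \<times> UNIV"
      then have "\<phi>'' (fst x) = 0" by (intro supp'') (auto simp: mem_Times_iff)
      then show "case_prod h x = 0" by (simp add: h_def case_prod_unfold)
    qed
  qed measurable
  \<comment> \<open>\<open>c / 2\<close> serves as lower limit because \<phi> and its derivative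
    vanish there, while \<open>supp\<close> is silent about \<open>c\<close> itself. For
    \<open>y\<close> at most \<open>c / 2\<close> the kernel and \<open>\<phi>''\<close> are never
    both nonzero.\<close>
  have inner: "(\<integral>r. h r y \<partial>lborel) = 2 * \<phi> y / y\<^sup>2" for y
  proof (cases "y \<le> c / 2")
    case True
    then have "h r y = 0" for r
      using supp''[of r] c by (cases "r < c") (auto simp: h_def)
    moreover have "\<phi> y = 0" using True c by (intro supp) auto
    ultimately show ?thesis by simp
  next
    case False
    have "(\<integral>r. h r y \<partial>lborel) = (\<integral>r. 2 / y\<^sup>2 * ((y - r) * \<phi>'' r * indicator {c / 2..y} r) \<partial>lborel)"
      using supp'' c
      by (intro Bochner_Integration.integral_cong) (auto simp: h_def max_def split: split_indicator)
    also have "\<dots> = 2 / y\<^sup>2 * (\<integral>r. (y - r) * \<phi>'' r * indicator {c / 2..y} r \<partial>lborel)"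
      by (simp only: integral_mult_right_zero)
    \<comment> \<open>Both integrations by parts at once:
      \<open>(y - r) * \<phi>' r + \<phi> r\<close> is a primitive, equal to \<open>\<phi> y\<close>
      at \<open>r = y\<close>.\<close>
    also have "(\<integral>r. (y - r) * \<phi>'' r * indicator {c / 2..y} r \<partial>lborel) =
        ((y - y) * \<phi>' y + \<phi> y) - ((y - c / 2) * \<phi>' (c / 2) + \<phi> (c / 2))"
    proof (rule integral_FTC_Icc_real)
      fix r
      show "((\<lambda>r. (y - r) * \<phi>' r + \<phi> r) has_real_derivative (y - r) * \<phi>'' r) (at r)"
        by (auto intro!: derivative_eq_intros \<phi> \<phi>')
      show "isCont (\<lambda>r. (y - r) * \<phi>'' r) r"
        using \<phi>'' by (auto intro!: continuous_intros simp: continuous_on_eq_continuous_at)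
    qed (use False in auto)
    finally show ?thesis using c supp[of "c / 2"] supp'[of "c / 2"] by simp
  qed
  have "(\<integral>r. remainder_density V \<nu> r * \<phi>'' r \<partial>lborel) = (\<integral>r. (\<integral>y. h r y \<partial>P) \<partial>lborel)"
  proof (intro Bochner_Integration.integral_cong refl)
    fix r :: real
    show "remainder_density V \<nu> r * \<phi>'' r = (\<integral>y. h r y \<partial>P)"
    proof (cases "c \<le> r")
      case True
      then show ?thesis using c
        unfolding h_def by (subst remainder_density_pos) (auto simp only: integral_mult_left_zero)
    qed (simp add: h_def supp'')
  qed
  also have "\<dots> = (\<integral>y. (\<integral>r. h r y \<partial>lborel) \<partial>P)"
    by (rule lp.Fubini_integral[OF int, symmetric])
  also have "\<dots> = (\<integral>y. 2 / V * ((V / y\<^sup>2) * \<phi> y) \<partial>P)"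
    using V_pos by (simp add: inner mult_ac)
  also have "\<dots> = 2 / V * (\<integral>x. \<phi> x \<partial>\<nu>)"
    unfolding integral_mult_right_zero by (simp add: integral_\<nu>)
  finally show ?thesis using V_pos by simp
qed

text \<open>The square is even and the atom sits at 0, so reflection preserves \<open>V\<close> and
  \<open>a\<close>. This is what carries the results on the positive half-line to the negative
  one.\<close>

lemma canonical_law_uminus: "canonical_law V a (distr \<nu> borel uminus) (distr P borel uminus)"
proof (rule canonical_law.intro)
  show "emeasure (distr \<nu> borel uminus) {0} = 0"
    using \<nu>_zero by (simp add: emeasure_distr vimage_def)
  show "prob_space (distr P borel uminus)" by (rule law.prob_space_distr) simp
  show "distr P borel uminus =
      scale_measure (ennreal (1 / V)) (canonical_measure a (distr \<nu> borel uminus))"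
  proof (rule measure_eqI)
    fix A assume "A \<in> sets (distr P borel uminus)"
    then have A[measurable]: "A \<in> sets borel" by simp
    have "uminus -` A \<in> sets (borel :: real measure)"
      using measurable_sets[of uminus borel borel A] by simp
    then show "emeasure (distr P borel uminus) A =
        emeasure (scale_measure (ennreal (1 / V)) (canonical_measure a (distr \<nu> borel uminus))) A"
      by (simp add: emeasure_distr emeasure_P emeasure_canonical_measure nn_integral_distr indicator_def)
  qed simp
qed (use V_pos a_nonneg in simp_all)

text \<open>The sign can be moved to the second factor:
  \<open>- (b * y) = b * (- y)\<close>.\<close>

lemma remainder_law_uminus: "remainder_law (distr P borel uminus) = distr (remainder_law P) borel uminus"
proof -
  interpret U: canonical_law V a "distr \<nu> borel uminus" "distr P borel uminus"
    by (rule canonical_law_uminus)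
  show ?thesis
  proof (rule measure_eqI)
    fix A assume "A \<in> sets (remainder_law (distr P borel uminus))"
    then have A[measurable]: "A \<in> sets borel" by simp
    have "uminus -` A \<in> sets (borel :: real measure)"
      using measurable_sets[of uminus borel borel A] by simp
    then show "emeasure (remainder_law (distr P borel uminus)) A =
        emeasure (distr (remainder_law P) borel uminus) A"
      by (simp add: U.emeasure_remainder_law emeasure_distr emeasure_remainder_law
          nn_integral_distr indicator_def sets_eq_imp_space_eq[OF sets_remainder_law])
  qed simp
qed

end

lemma remainder_density_uminus:
  assumes [measurable_cong]: "sets \<nu> = sets borel"
  shows "remainder_density V (distr \<nu> borel uminus) r = remainder_density V \<nu> (- r)"
proof -
  have "(LINT x:{r<..}|distr \<nu> borel uminus. x - r) = (LINT x:{..<-r}|\<nu>. - r - x)"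
    unfolding set_lebesgue_integral_def
    by (subst integral_distr) (auto intro!: Bochner_Integration.integral_cong split: split_indicator)
  moreover have "(LINT x:{..<r}|distr \<nu> borel uminus. r - x) = (LINT x:{-r<..}|\<nu>. x - - r)"
    unfolding set_lebesgue_integral_def
    by (subst integral_distr) (auto intro!: Bochner_Integration.integral_cong split: split_indicator)
  ultimately show ?thesis by (simp add: remainder_density_def)
qed

section \<open>Recovering the canonical law from the remainder\<close>

text \<open>By the half-angle formula the quotient is the square of
  \<open>sin (u / 2) / (u / 2)\<close>, the characteristic function of the triangular law on
  [-1, 1]. The bounds and the limit at 0 are what dominated convergence asks of it.\<close>

lemma one_minus_cos_quotient:
  fixes u :: real
  defines "c \<equiv> \<lambda>u::real. if u = 0 then 1 else (2 - 2 * cos u) / u\<^sup>2"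
  shows one_minus_cos_quotient_nonneg: "0 \<le> c u" and one_minus_cos_quotient_le_1: "c u \<le> 1"
    and tendsto_one_minus_cos_quotient: "c \<midarrow>0\<rightarrow> 1"
proof -
  have eq: "2 - 2 * cos u = 4 * (sin (u / 2))\<^sup>2" for u :: real
    using cos_double_sin[of "u / 2"] by simp
  have "4 * (sin (u / 2))\<^sup>2 \<le> 4 * (u / 2)\<^sup>2"
    using abs_sin_x_le_abs_x[of "u / 2"] by (intro mult_left_mono) (simp_all flip: abs_le_square_iff)
  then show "c u \<le> 1"
    by (cases "u = 0") (simp_all add: c_def eq[of u] power_divide divide_le_eq)
  show "0 \<le> c u" by (simp add: c_def)
  have "((\<lambda>h. (sin (0 + h) - sin 0) / h) \<longlongrightarrow> cos 0) (at (0::real))"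
    using DERIV_sin[of "0::real"] unfolding DERIV_def .
  then have "((\<lambda>u. sin u / u) \<longlongrightarrow> 1) (at (0::real))" by simp
  moreover have "filterlim (\<lambda>u::real. u / 2) (at 0) (at 0)"
    unfolding filterlim_at by (auto intro!: tendsto_eq_intros simp: eventually_at_filter)
  ultimately have "((\<lambda>u. sin (u / 2) / (u / 2)) \<longlongrightarrow> 1) (at (0::real))"
    by (rule filterlim_compose)
  then have "((\<lambda>u. (sin (u / 2) / (u / 2))\<^sup>2) \<longlongrightarrow> 1\<^sup>2) (at (0::real))"
    by (rule tendsto_power)
  moreover have "eventually (\<lambda>u. (sin (u / 2) / (u / 2))\<^sup>2 = c u) (at 0)"
    by (auto simp: c_def eq eventually_at_filter power_divide)
  ultimately show "c \<midarrow>0\<rightarrow> 1"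
    using Lim_transform_eventually by fastforce
qed

text \<open>The Beta identity at \<open>\<i> * s * y\<close> evaluates
  \<open>y\<^sup>2 * s\<^sup>2 * \<kappa> (s * y)\<close> as
  \<open>- 2 * (iexp (s * y) - 1 - \<i> * s * y)\<close>. The part affine in \<open>s\<close>
  cancels in a second difference, leaving \<open>iexp (t * y)\<close> times a cosine
  expression.\<close>

lemma second_difference_kernel:
  fixes t h y :: real and \<kappa> :: "real \<Rightarrow> complex" and c :: "real \<Rightarrow> real"
  defines "\<kappa> \<equiv> \<lambda>u::real. CLINT b|beta_law. iexp (u * b)"
    and "c \<equiv> \<lambda>u::real. if u = 0 then 1 else (2 - 2 * cos u) / u\<^sup>2"
  assumes h: "h \<noteq> 0"
  shows "of_real ((t + h)\<^sup>2) * \<kappa> ((t + h) * y) + of_real ((t - h)\<^sup>2) * \<kappa> ((t - h) * y) - 2 * (of_real (t\<^sup>2) * \<kappa> (t * y)) =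
    of_real (2 * h\<^sup>2) * (iexp (t * y) * c (h * y))"
proof (cases "y = 0")
  \<comment> \<open>The general case ends by cancelling \<open>y\<^sup>2\<close>, so
    \<open>y = 0\<close> is checked directly, with \<open>c 0 = 1\<close>.\<close>
  case True
  have "\<kappa> 0 = 1" by (simp add: \<kappa>_def)
  then show ?thesis using True by (simp add: c_def algebra_simps power2_eq_square)
next
  case False
  have \<kappa>: "(of_real u)\<^sup>2 * \<kappa> u = - 2 * (iexp u - 1 - \<i> * u)" for u
    using integral_exp_beta_law[of "\<i> * of_real u"] by (simp add: \<kappa>_def power_mult_distrib mult.assoc algebra_simps)
  have \<kappa>': "of_real (y\<^sup>2) * (of_real (s\<^sup>2) * \<kappa> (s * y)) = - 2 * (iexp (s * y) - 1 - \<i> * (s * y))" for s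
    using \<kappa>[of "s * y"] by (simp add: power_mult_distrib mult_ac)
  have "of_real (y\<^sup>2) * (of_real ((t + h)\<^sup>2) * \<kappa> ((t + h) * y) + of_real ((t - h)\<^sup>2) * \<kappa> ((t - h) * y) - 2 * (of_real (t\<^sup>2) * \<kappa> (t * y))) =
      of_real (y\<^sup>2) * (of_real ((t + h)\<^sup>2) * \<kappa> ((t + h) * y)) + of_real (y\<^sup>2) * (of_real ((t - h)\<^sup>2) * \<kappa> ((t - h) * y)) - 2 * (of_real (y\<^sup>2) * (of_real (t\<^sup>2) * \<kappa> (t * y)))"
    by (simp add: algebra_simps)
  also have "\<dots> = - 2 * (iexp ((t + h) * y) + iexp ((t - h) * y) - 2 * iexp (t * y))"
    unfolding \<kappa>' by (simp add: algebra_simps)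
  also have "iexp ((t + h) * y) = iexp (t * y) * iexp (h * y)"
    by (simp add: algebra_simps flip: exp_add)
  also have "iexp ((t - h) * y) = iexp (t * y) * iexp (- (h * y))"
    by (simp add: algebra_simps flip: exp_add)
  also have "- 2 * (iexp (t * y) * iexp (h * y) + iexp (t * y) * iexp (- (h * y)) - 2 * iexp (t * y)) =
      iexp (t * y) * (2 * (2 - (iexp (h * y) + iexp (- (h * y)))))"
    by (simp add: algebra_simps)
  also have "iexp (h * y) + iexp (- (h * y)) = of_real (2 * cos (h * y))"
    by (simp add: complex_eq_iff Re_exp Im_exp)
  also have "2 * (2 - complex_of_real (2 * cos (h * y))) = of_real (2 * (h * y)\<^sup>2 * c (h * y))"
    using False h by (simp add: c_def)
  finally have "of_real (y\<^sup>2) * (of_real ((t + h)\<^sup>2) * \<kappa> ((t + h) * y) + of_real ((t - h)\<^sup>2) * \<kappa> ((t - h) * y) - 2 * (of_real (t\<^sup>2) * \<kappa> (t * y))) =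
      y\<^sup>2 * (of_real (2 * h\<^sup>2) * (iexp (t * y) * c (h * y)))"
    by (simp add: power_mult_distrib mult_ac)
  then show ?thesis using False by simp
qed

context canonical_law
begin

text \<open>As \<open>t\<^sup>2\<close> times the characteristic function of the remainder is twice the integral of
  \<open>(1 + ity - exp (ity)) / y\<^sup>2\<close>, second differences in \<open>t\<close> recover the characteristic
  function of \<open>P\<close>.\<close>

lemma second_difference_char_remainder_law:
  fixes t :: real and \<theta> :: "real \<Rightarrow> complex" and h :: "nat \<Rightarrow> real"
  defines "\<theta> \<equiv> \<lambda>t. of_real (t\<^sup>2) * char (remainder_law P) t" and "h \<equiv> \<lambda>n. inverse (real (Suc n))"
  shows "(\<lambda>n. (\<theta> (t + h n) + \<theta> (t - h n) - 2 * \<theta> t) / of_real (2 * (h n)\<^sup>2)) \<longlonglongrightarrow> char P t"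
proof -
  define \<kappa> :: "real \<Rightarrow> complex" where "\<kappa> u = (CLINT b|beta_law. iexp (u * b))" for u :: real
  define c :: "real \<Rightarrow> real" where "c u = (if u = 0 then 1 else (2 - 2 * cos u) / u\<^sup>2)" for u :: real
  have h: "h n \<noteq> 0" for n by (simp add: h_def)
  have \<kappa>_meas[measurable]: "\<kappa> \<in> borel_measurable borel"
    unfolding \<kappa>_def by measurable
  have c_meas[measurable]: "c \<in> borel_measurable borel"
    unfolding c_def by measurable
  have "norm (\<kappa> u) \<le> 1" for u
  proof -
    have "norm (\<kappa> u) \<le> (\<integral>b. norm (iexp (u * b)) \<partial>beta_law)" unfolding \<kappa>_def by (rule integral_norm_bound)
    then show ?thesis by simp
  qed
  then have \<kappa>_int: "integrable P (\<lambda>y. \<kappa> (s * y))" for s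
    by (intro law.integrable_const_bound[where B=1]) auto
  have \<theta>: "\<theta> s = (CLINT y|P. of_real (s\<^sup>2) * \<kappa> (s * y))" for s
    by (simp add: \<theta>_def char_remainder_law \<kappa>_def mult_ac)
  have "(\<theta> (t + h n) + \<theta> (t - h n) - 2 * \<theta> t) / of_real (2 * (h n)\<^sup>2) = (CLINT y|P. iexp (t * y) * c (h n * y))" for n
  proof -
    have "\<theta> (t + h n) + \<theta> (t - h n) - 2 * \<theta> t =
        (CLINT y|P. of_real ((t + h n)\<^sup>2) * \<kappa> ((t + h n) * y) + of_real ((t - h n)\<^sup>2) * \<kappa> ((t - h n) * y) - 2 * (of_real (t\<^sup>2) * \<kappa> (t * y)))"
      unfolding \<theta> using \<kappa>_int by simp
    also have "\<dots> = (CLINT y|P. of_real (2 * (h n)\<^sup>2) * (iexp (t * y) * c (h n * y)))"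
      unfolding \<kappa>_def c_def by (intro Bochner_Integration.integral_cong refl second_difference_kernel h)
    finally show ?thesis using h[of n] by simp
  qed
  \<comment> \<open>The multiplier \<open>c (h n * y)\<close> tends to 1 and stays in [0, 1], so the
    constant 1 dominates.\<close>
  moreover have "(\<lambda>n. CLINT y|P. iexp (t * y) * c (h n * y)) \<longlonglongrightarrow> (CLINT y|P. iexp (t * y))"
  proof (rule integral_dominated_convergence[where w = "\<lambda>_. 1"])
    show "AE y in P. (\<lambda>n. iexp (t * y) * c (h n * y)) \<longlonglongrightarrow> iexp (t * y)"
    proof (intro AE_I2)
      fix y
      have c0: "isCont c 0"
        using tendsto_one_minus_cos_quotient unfolding isCont_def c_def by simp
      have "h \<longlonglongrightarrow> 0" unfolding h_def by (rule LIMSEQ_inverse_real_of_nat)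
      then have "(\<lambda>n. h n * y) \<longlonglongrightarrow> 0" by (auto intro!: tendsto_eq_intros)
      then have "(\<lambda>n. c (h n * y)) \<longlonglongrightarrow> c 0" by (rule isCont_tendsto_compose[OF c0])
      then have "(\<lambda>n. iexp (t * y) * c (h n * y)) \<longlonglongrightarrow> iexp (t * y) * of_real (c 0)"
        by (intro tendsto_intros)
      then show "(\<lambda>n. iexp (t * y) * c (h n * y)) \<longlonglongrightarrow> iexp (t * y)" by (simp add: c_def)
    qed
    show "AE y in P. norm (iexp (t * y) * c (h n * y)) \<le> 1" for n
      using one_minus_cos_quotient_nonneg[of "h n * y" for y] one_minus_cos_quotient_le_1[of "h n * y" for y]
      unfolding c_def[symmetric] by (intro AE_I2) (simp add: norm_mult)
  qed auto
  ultimately show ?thesis by (simp add: char_def)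
qed

end

text \<open>Equal remainder laws give equal second differences, hence equal characteristic functions
  of the canonical laws. Then \<open>a\<close> is \<open>V\<close> times the mass at 0 and \<nu> is
  recovered by its density; the common \<open>V\<close> enters both formulas.\<close>

lemma canonical_law_unique:
  assumes "canonical_law V a \<nu> P" "canonical_law V a' \<nu>' P'" and eq: "remainder_law P' = remainder_law P"
  shows "a' = a" "\<nu>' = \<nu>"
proof -
  interpret A: canonical_law V a \<nu> P by fact
  interpret B: canonical_law V a' \<nu>' P' by fact
  have "char P' t = char P t" for t
    using A.second_difference_char_remainder_law[of t] B.second_difference_char_remainder_law[of t]
    unfolding eq by (rule LIMSEQ_unique[rotated])
  then have P: "P' = P"
    by (intro Levy_uniqueness A.real_distribution_P B.real_distribution_P ext)
  show "a' = a"
    using A.measure_P_zero B.measure_P_zero A.V_pos by (simp add: P)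
  show "\<nu>' = \<nu>"
    using A.\<nu>_density B.\<nu>_density by (simp add: P)
qed

section \<open>Compound Poisson laws\<close>

text \<open>The cumulants here are nonnegative, as \<open>exp z - 1 - z\<close> is, so
  [0, \<infinity>] is the right domain. The infinite value lets the moment formula be stated without
  a finiteness assumption, and \<open>ln_ennreal\<close> inverts it.\<close>

definition ennreal_exp :: "ennreal \<Rightarrow> ennreal" where
  "ennreal_exp x = (if x = \<infinity> then \<infinity> else ennreal (exp (enn2real x)))"

lemma ennreal_exp_ennreal: "0 \<le> x \<Longrightarrow> ennreal_exp (ennreal x) = ennreal (exp x)"
  by (simp add: ennreal_exp_def)

lemma ennreal_exp_top [simp]: "ennreal_exp top = top"
  by (simp add: ennreal_exp_def)

lemma ennreal_exp_add: "ennreal_exp (x + y) = ennreal_exp x * ennreal_exp y"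
proof (cases "x = \<infinity> \<or> y = \<infinity>")
  case True
  then show ?thesis
    by (auto simp: ennreal_exp_def ennreal_mult_top ennreal_top_mult)
next
  case False
  then show ?thesis
    by (cases x; cases y)
       (auto simp: ennreal_exp_ennreal exp_add ennreal_mult simp flip: ennreal_plus)
qed

lemma ennreal_exp_mono:
  assumes "x \<le> y" shows "ennreal_exp x \<le> ennreal_exp y"
proof (cases "y = top")
  case False
  then have "x \<noteq> top" "y < top" using assms by (auto simp: top_unique top.not_eq_extremum)
  then show ?thesis
    using enn2real_mono[OF assms] by (simp add: ennreal_exp_def ennreal_leI)
qed simp

lemma ln_ennreal_exp: "ln_ennreal (ennreal_exp x) = enn2ereal x"
proof (cases x)
  case (real r)
  then show ?thesis by (simp add: ln_ennreal_def ennreal_exp_ennreal)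
next
  case top
  then show ?thesis by (simp add: ln_ennreal_def top_ereal_def)
qed

text \<open>Supplies an infinite i.i.d. sequence, since a random sum draws on arbitrarily many
  variables.\<close>

lemma indep_vars_PiM_components:
  assumes Q: "prob_space Q" "sets Q = sets borel"
  shows "prob_space.indep_vars (Pi\<^sub>M UNIV (\<lambda>_::'i. Q)) (\<lambda>_. borel) (\<lambda>i \<omega>. \<omega> i :: real) UNIV"
proof -
  interpret Q: prob_space Q by fact
  interpret prob_space "Pi\<^sub>M UNIV (\<lambda>_::'i. Q)" by (intro prob_space_PiM Q)
  have [measurable_cong]: "sets Q = sets borel" by fact
  have comp: "distr (Pi\<^sub>M UNIV (\<lambda>_::'i. Q)) borel (\<lambda>\<omega>. \<omega> i) = Q" for i
    using distr_PiM_component[of UNIV "\<lambda>_. Q" i] Q by (simp cong: distr_cong)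
  have s: "sets (Pi\<^sub>M UNIV (\<lambda>_::'i. borel :: real measure)) = sets (Pi\<^sub>M UNIV (\<lambda>_::'i. Q))"
    using Q(2) by (intro sets_PiM_cong) auto
  have "distr (Pi\<^sub>M UNIV (\<lambda>_::'i. Q)) (Pi\<^sub>M UNIV (\<lambda>_. borel)) (\<lambda>x. \<lambda>i\<in>UNIV. x i) = Pi\<^sub>M UNIV (\<lambda>_::'i. Q)"
    by (simp add: restrict_UNIV distr_id2[OF s])
  then show ?thesis
    by (subst indep_vars_iff_distr_eq_PiM) (auto simp: comp)
qed

text \<open>Applied at a value \<open>c\<close> of a characteristic function, hence the closed unit
  disc.\<close>

lemma poisson_generating_function:
  fixes c :: complex
  assumes "0 < r" "norm c \<le> 1"
  shows "(CLINT n|measure_pmf (poisson_pmf r). c ^ n) = exp (of_real r * (c - 1))"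
proof -
  have "(\<lambda>n. (of_real r * c) ^ n /\<^sub>R fact n) sums exp (of_real r * c)"
    by (rule exp_converges)
  then have "(\<lambda>n. exp (- of_real r) * ((of_real r * c) ^ n /\<^sub>R fact n)) sums (exp (- of_real r) * exp (of_real r * c))"
    by (rule sums_mult)
  also have "(\<lambda>n. exp (- of_real r) * ((of_real r * c) ^ n /\<^sub>R fact n)) = (\<lambda>n. pmf (poisson_pmf r) n *\<^sub>R c ^ n)"
    using assms by (auto simp: scaleR_conv_of_real power_mult_distrib divide_inverse exp_of_real[symmetric] mult_ac)
  also have "exp (- of_real r) * exp (of_real r * c) = exp (of_real r * (c - 1))"
    by (simp add: algebra_simps flip: exp_add)
  finally have s: "(\<lambda>n. pmf (poisson_pmf r) n *\<^sub>R c ^ n) sums exp (of_real r * (c - 1))" .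
  have "integrable (measure_pmf (poisson_pmf r)) (\<lambda>n. c ^ n)"
    using assms(2) by (intro measure_pmf.integrable_const_bound[where B=1]) (auto simp: norm_power power_le_one)
  then have "integrable (count_space UNIV) (\<lambda>n. pmf (poisson_pmf r) n *\<^sub>R c ^ n)"
    unfolding measure_pmf_eq_density by (subst (asm) integrable_density) auto
  from sums_integral_count_space_nat[OF this] s
  have "(CLINT n|count_space UNIV. pmf (poisson_pmf r) n *\<^sub>R c ^ n) = exp (of_real r * (c - 1))"
    by (rule sums_unique2)
  then show ?thesis
    unfolding measure_pmf_eq_density by (subst integral_density) auto
qed

text \<open>The counterpart for exponential moments, where \<open>m\<close> may be infinite; the
  summand at \<open>n = 1\<close>, of positive weight, then already diverges.\<close>

lemma poisson_generating_function_nn: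
  fixes m :: ennreal
  assumes r: "0 < r"
  shows "(\<integral>\<^sup>+n. m ^ n \<partial>measure_pmf (poisson_pmf r)) = (if m = \<infinity> then \<infinity> else ennreal (exp (r * (enn2real m - 1))))"
proof (cases m)
  case (real c)
  have "(\<lambda>n. exp (- r) * ((r * c) ^ n /\<^sub>R fact n)) sums (exp (- r) * exp (r * c))"
    by (intro sums_mult exp_converges)
  also have "exp (- r) * exp (r * c) = exp (r * (c - 1))"
    by (simp add: algebra_simps flip: exp_add)
  finally have s: "(\<lambda>n. exp (- r) * ((r * c) ^ n /\<^sub>R fact n)) sums exp (r * (c - 1))" .
  have "(\<integral>\<^sup>+n. m ^ n \<partial>measure_pmf (poisson_pmf r)) = (\<Sum>n. ennreal (pmf (poisson_pmf r) n) * m ^ n)"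
    by (simp add: nn_integral_measure_pmf nn_integral_count_space_nat)
  also have "\<dots> = (\<Sum>n. ennreal (exp (- r) * ((r * c) ^ n /\<^sub>R fact n)))"
    using real r by (intro suminf_cong)
      (simp add: ennreal_power power_mult_distrib divide_inverse mult_ac flip: ennreal_mult)
  also have "\<dots> = ennreal (exp (r * (c - 1)))"
    using real r s by (intro suminf_ennreal_eq) auto
  finally show ?thesis using real by simp
next
  case top
  have "\<infinity> = ennreal (pmf (poisson_pmf r) 1) * m ^ 1"
    using r top by (simp add: ennreal_mult_top)
  also have "\<dots> \<le> (\<integral>\<^sup>+n. ennreal (pmf (poisson_pmf r) n) * m ^ n \<partial>count_space UNIV)"
    using sum_le_suminf[OF summableI, of "{1}" "\<lambda>n. ennreal (pmf (poisson_pmf r) n) * m ^ n"]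
    by (simp add: nn_integral_count_space_nat del: pmf_poisson)
  finally have "\<infinity> \<le> (\<integral>\<^sup>+n. ennreal (pmf (poisson_pmf r) n) * m ^ n \<partial>count_space UNIV)" .
  then show ?thesis using top
    by (simp only: nn_integral_measure_pmf top_unique infinity_ennreal_def) simp
qed

text \<open>\<open>D\<close> is the law of a sum of i.i.d. jumps with law \<open>Q\<close>, the
  normalization of \<rho>, their number being Poisson with rate the total mass \<open>r\<close>.
  Conditioning on the number reduces both transforms to the Poisson generating function.\<close>

lemma compound_poisson:
  assumes "finite_measure \<rho>" and sets_\<rho>: "sets \<rho> = sets borel"
  obtains D where "real_distribution D"
    "\<And>s. char D s = exp (CLINT x|\<rho>. iexp (s * x) - 1)"
    "\<And>t. (\<integral>\<^sup>+x. ennreal (exp (t * x)) \<partial>D) =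
       (if (\<integral>\<^sup>+x. ennreal (exp (t * x)) \<partial>\<rho>) = \<infinity> then \<infinity>
        else ennreal (exp (enn2real (\<integral>\<^sup>+x. ennreal (exp (t * x)) \<partial>\<rho>) - measure \<rho> UNIV)))"
proof (cases "measure \<rho> UNIV = 0")
  interpret \<rho>: finite_measure \<rho> by fact
  have sp: "space \<rho> = UNIV" using sets_eq_imp_space_eq[OF sets_\<rho>] by simp
  \<comment> \<open>A zero measure cannot be normalized; the point mass at 0 takes the place of the
    random sum.\<close>
  case True
  then have AE: "AE x in \<rho>. False"
    using AE_iff_measurable[of UNIV \<rho> "\<lambda>_. False"] by (simp add: sp \<rho>.emeasure_eq_measure sets_\<rho>)
  interpret D: real_distribution "return borel (0::real)"
    by (intro real_distribution.intro real_distribution_axioms.intro prob_space_return) auto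
  have "char (return borel 0) s = exp (CLINT x|\<rho>. iexp (s * x) - 1)" for s
    using AE by (subst integral_eq_zero_AE) (auto simp: char_def integral_return elim: eventually_mono)
  moreover have "(\<integral>\<^sup>+x. ennreal (exp (t * x)) \<partial>\<rho>) = 0" for t
    using AE by (subst nn_integral_cong_AE[where v = "\<lambda>_. 0"]) (auto elim: eventually_mono)
  ultimately show ?thesis
    using D.real_distribution_axioms True by (intro that[of "return borel 0"]) (auto simp: nn_integral_return)
next
  interpret \<rho>: finite_measure \<rho> by fact
  have sp: "space \<rho> = UNIV" using sets_eq_imp_space_eq[OF sets_\<rho>] by simp
  define r where "r = measure \<rho> UNIV"
  case False
  then have r: "0 < r" unfolding r_def using measure_nonneg[of \<rho> UNIV] by linarith
  define Q where "Q = density \<rho> (\<lambda>_. ennreal (1 / r))"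
  have sets_Q[simp, measurable_cong]: "sets Q = sets borel" by (simp add: Q_def sets_\<rho>)
  have nn_Q: "(\<integral>\<^sup>+x. f x \<partial>\<rho>) = ennreal r * (\<integral>\<^sup>+x. f x \<partial>Q)" if [measurable]: "f \<in> borel_measurable borel" for f
  proof -
    have "f \<in> borel_measurable \<rho>" using that sets_\<rho> by (simp cong: measurable_cong_sets)
    then have "ennreal r * (\<integral>\<^sup>+x. f x \<partial>Q) = (ennreal r * ennreal (1 / r)) * (\<integral>\<^sup>+x. f x \<partial>\<rho>)"
      by (simp add: Q_def nn_integral_density nn_integral_cmult mult.assoc)
    also have "ennreal r * ennreal (1 / r) = 1" using r by (simp flip: ennreal_mult)
    finally show ?thesis by simp
  qed
  have "prob_space Q"
  proof
    have "emeasure Q (space Q) = ennreal (1 / r) * emeasure \<rho> UNIV"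
      by (simp add: Q_def emeasure_density sp sets_\<rho>)
    also have "\<dots> = 1"
      using r by (simp add: \<rho>.emeasure_eq_measure r_def[symmetric] flip: ennreal_mult)
    finally show "emeasure Q (space Q) = 1" .
  qed
  then interpret Q: prob_space Q .
  define N where "N = measure_pmf (poisson_pmf r)"
  define \<Omega> where "\<Omega> = (Pi\<^sub>M UNIV (\<lambda>_::nat. Q))"
  interpret N: prob_space N unfolding N_def by (rule measure_pmf.prob_space_axioms)
  interpret \<Omega>: prob_space \<Omega> unfolding \<Omega>_def by (intro prob_space_PiM Q.prob_space_axioms)
  interpret N\<Omega>: pair_prob_space N \<Omega> ..
  have sets_N: "sets N = sets (count_space UNIV)" by (simp add: N_def)
  have ind: "\<Omega>.indep_vars (\<lambda>_. borel) (\<lambda>i \<omega>. \<omega> i) UNIV"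
    unfolding \<Omega>_def by (rule indep_vars_PiM_components) (simp_all add: Q.prob_space_axioms)
  have ind': "\<Omega>.indep_vars (\<lambda>_. borel) (\<lambda>i \<omega>. \<omega> i) {..<n}" for n
    by (rule \<Omega>.indep_vars_subset[OF ind]) simp
  have comp: "distr \<Omega> borel (\<lambda>\<omega>. \<omega> i) = Q" for i
    using distr_PiM_component[of UNIV "\<lambda>_. Q" i] Q.prob_space_axioms by (simp add: \<Omega>_def cong: distr_cong)
  have [measurable]: "(\<lambda>\<omega>. \<omega> i) \<in> borel_measurable \<Omega>" for i
    unfolding \<Omega>_def by measurable
  define S where "S = (\<lambda>(n::nat, \<omega>::nat \<Rightarrow> real). \<Sum>i<n. \<omega> i)"
  have S[measurable]: "S \<in> borel_measurable (N \<Otimes>\<^sub>M \<Omega>)"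
  proof -
    have "S \<in> borel_measurable (count_space UNIV \<Otimes>\<^sub>M \<Omega>)"
      by (rule measurable_pair_measure_countable1) (auto simp: S_def)
    then show ?thesis
      by (subst measurable_cong_sets[OF sets_pair_measure_cong[OF sets_N refl] refl])
  qed
  define D where "D = distr (N \<Otimes>\<^sub>M \<Omega>) borel S"
  have "real_distribution D" unfolding D_def by (rule N\<Omega>.P.real_distribution_distr) measurable
  moreover have "char D s = exp (CLINT x|\<rho>. iexp (s * x) - 1)" for s
  proof -
    have "char D s = (CLINT p|N \<Otimes>\<^sub>M \<Omega>. iexp (s * S p))"
      unfolding D_def char_def by (subst integral_distr) auto
    also have "\<dots> = (CLINT n|N. CLINT \<omega>|\<Omega>. iexp (s * S (n, \<omega>)))"
      by (rule N\<Omega>.integral_fst'[symmetric]) (auto intro!: N\<Omega>.P.integrable_const_bound[where B=1])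
    also have "\<dots> = (CLINT n|N. char Q s ^ n)"
    proof (intro Bochner_Integration.integral_cong refl)
      fix n
      have "(CLINT \<omega>|\<Omega>. iexp (s * S (n, \<omega>))) = char (distr \<Omega> borel (\<lambda>\<omega>. \<Sum>i<n. \<omega> i)) s"
        unfolding char_def by (subst integral_distr) (auto simp: S_def)
      also have "\<dots> = char Q s ^ n"
        using \<Omega>.char_distr_sum[OF ind', of n s] by (simp add: comp)
      finally show "(CLINT \<omega>|\<Omega>. iexp (s * S (n, \<omega>))) = char Q s ^ n" .
    qed
    also have "\<dots> = exp (of_real r * (char Q s - 1))"
    proof -
      interpret Q: real_distribution Q by unfold_locales simp
      show ?thesis unfolding N_def by (intro poisson_generating_function r Q.cmod_char_le_1)
    qed
    also have "of_real r * (char Q s - 1) = (CLINT x|\<rho>. iexp (s * x) - 1)"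
    proof -
      have m: "(\<lambda>x. iexp (s * x)) \<in> borel_measurable \<rho>" using sets_\<rho> by (simp cong: measurable_cong_sets)
      then have "char Q s = (1 / r) *\<^sub>R (CLINT x|\<rho>. iexp (s * x))"
        unfolding char_def Q_def using r by (subst integral_density) auto
      then have "of_real r * char Q s = (CLINT x|\<rho>. iexp (s * x))"
        using r by (simp add: scaleR_conv_of_real)
      moreover have "integrable \<rho> (\<lambda>x. iexp (s * x))"
        using m by (intro \<rho>.integrable_const_bound[where B=1]) auto
      ultimately show ?thesis
        by (simp add: right_diff_distrib sp r_def scaleR_conv_of_real)
    qed
    finally show ?thesis .
  qed
  moreover have "(\<integral>\<^sup>+x. ennreal (exp (t * x)) \<partial>D) =
       (if (\<integral>\<^sup>+x. ennreal (exp (t * x)) \<partial>\<rho>) = \<infinity> then \<infinity>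
        else ennreal (exp (enn2real (\<integral>\<^sup>+x. ennreal (exp (t * x)) \<partial>\<rho>) - measure \<rho> UNIV)))" for t
  proof -
    define m where "m = (\<integral>\<^sup>+x. ennreal (exp (t * x)) \<partial>Q)"
    have m: "(\<integral>\<^sup>+x. ennreal (exp (t * x)) \<partial>\<rho>) = ennreal r * m"
      unfolding m_def by (rule nn_Q) measurable
    have "(\<integral>\<^sup>+x. ennreal (exp (t * x)) \<partial>D) = (\<integral>\<^sup>+p. ennreal (exp (t * S p)) \<partial>(N \<Otimes>\<^sub>M \<Omega>))"
      unfolding D_def by (subst nn_integral_distr) auto
    also have "\<dots> = (\<integral>\<^sup>+n. \<integral>\<^sup>+\<omega>. ennreal (exp (t * S (n, \<omega>))) \<partial>\<Omega> \<partial>N)"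
      by (rule \<Omega>.nn_integral_fst[symmetric]) measurable
    also have "\<dots> = (\<integral>\<^sup>+n. m ^ n \<partial>N)"
    proof (intro nn_integral_cong)
      fix n
      have "(\<integral>\<^sup>+\<omega>. ennreal (exp (t * S (n, \<omega>))) \<partial>\<Omega>) = (\<integral>\<^sup>+\<omega>. (\<Prod>i<n. ennreal (exp (t * \<omega> i))) \<partial>\<Omega>)"
        by (simp add: S_def sum_distrib_left exp_sum prod_ennreal)
      also have "\<dots> = (\<Prod>i<n. \<integral>\<^sup>+\<omega>. ennreal (exp (t * \<omega> i)) \<partial>\<Omega>)"
        by (intro \<Omega>.indep_vars_nn_integral \<Omega>.indep_vars_compose2[OF ind']) auto
      also have "\<dots> = m ^ n"
      proof -
        have "(\<integral>\<^sup>+\<omega>. ennreal (exp (t * \<omega> i)) \<partial>\<Omega>) = m" for i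
          unfolding m_def comp[of i, symmetric] by (subst nn_integral_distr) auto
        then show ?thesis by simp
      qed
      finally show "(\<integral>\<^sup>+\<omega>. ennreal (exp (t * S (n, \<omega>))) \<partial>\<Omega>) = m ^ n" .
    qed
    also have "\<dots> = (if m = \<infinity> then \<infinity> else ennreal (exp (r * (enn2real m - 1))))"
      unfolding N_def by (rule poisson_generating_function_nn[OF r])
    also have "\<dots> = (if ennreal r * m = \<infinity> then \<infinity> else ennreal (exp (enn2real (ennreal r * m) - r)))"
      using r by (cases m) (auto simp: ennreal_mult_top algebra_simps simp flip: ennreal_mult)
    finally show ?thesis by (simp add: m r_def)
  qed
  ultimately show ?thesis by (rule that)
qed

section \<open>Compensated compound Poisson laws with a Gaussian part\<close>

lemma real_distribution_convolution:
  assumes "real_distribution D" "real_distribution E"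
  shows "real_distribution (D \<star> E)"
proof -
  interpret D: real_distribution D by fact
  interpret E: real_distribution E by fact
  interpret pair_prob_space D E ..
  show ?thesis unfolding convolution_def by (rule P.real_distribution_distr) measurable
qed

lemma char_convolution:
  assumes "real_distribution D" "real_distribution E"
  shows "char (D \<star> E) s = char D s * char E s"
proof -
  interpret D: real_distribution D by fact
  interpret E: real_distribution E by fact
  interpret pair_prob_space D E ..
  have "char (D \<star> E) s = (CLINT p|D \<Otimes>\<^sub>M E. iexp (s * (fst p + snd p)))"
    unfolding char_def convolution_def by (subst integral_distr) (auto simp: case_prod_unfold)
  also have "\<dots> = (CLINT x|D. CLINT y|E. iexp (s * (x + y)))"
    by (subst integral_fst'[symmetric]) (auto intro!: P.integrable_const_bound[where B=1])
  also have "\<dots> = char D s * char E s"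
    by (simp add: char_def distrib_left exp_add)
  finally show ?thesis .
qed

lemma mgf_convolution:
  assumes "real_distribution D" "real_distribution E"
  shows "(\<integral>\<^sup>+x. ennreal (exp (t * x)) \<partial>(D \<star> E)) =
    (\<integral>\<^sup>+x. ennreal (exp (t * x)) \<partial>D) * (\<integral>\<^sup>+x. ennreal (exp (t * x)) \<partial>E)"
proof -
  interpret D: real_distribution D by fact
  interpret E: real_distribution E by fact
  show ?thesis
    by (subst nn_integral_convolution)
       (auto simp: distrib_left exp_add ennreal_mult nn_integral_cmult nn_integral_multc
          intro: D.finite_measure_axioms E.finite_measure_axioms)
qed

text \<open>Scaling a standard normal variable by \<open>sqrt a\<close> keeps \<open>a = 0\<close>
  inside the same formula, as the point mass at 0.\<close>

lemma gaussian_law: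
  fixes a :: real
  assumes "0 \<le> a"
  obtains G where "real_distribution G" "\<And>s. char G s = of_real (exp (- (a * s\<^sup>2 / 2)))"
    "\<And>t. (\<integral>\<^sup>+x. ennreal (exp (t * x)) \<partial>G) = ennreal (exp (a * t\<^sup>2 / 2))"
proof -
  interpret Z: real_distribution std_normal_distribution by (rule real_dist_normal_dist)
  define G where "G = distr std_normal_distribution borel (\<lambda>x. sqrt a * x)"
  have "real_distribution G" unfolding G_def by (rule Z.real_distribution_distr) simp
  moreover have "char G s = of_real (exp (- (a * s\<^sup>2 / 2)))" for s
  proof -
    have "char G s = char std_normal_distribution (s * sqrt a)"
      unfolding G_def char_def by (subst integral_distr) (auto simp: mult_ac)
    then show ?thesis
      using assms by (simp add: char_std_normal_distribution power_mult_distrib mult.commute)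
  qed
  moreover have "(\<integral>\<^sup>+x. ennreal (exp (t * x)) \<partial>G) = ennreal (exp (a * t\<^sup>2 / 2))" for t
  proof -
    define u where "u = t * sqrt a"
    have "(\<integral>\<^sup>+x. ennreal (exp (t * x)) \<partial>G) = (\<integral>\<^sup>+x. ennreal (exp (u * x)) \<partial>std_normal_distribution)"
      unfolding G_def by (subst nn_integral_distr) (auto simp: u_def mult_ac)
    also have "\<dots> = (\<integral>\<^sup>+x. ennreal (exp (u\<^sup>2 / 2)) * ennreal (normal_density u 1 x) \<partial>lborel)"
    proof (subst nn_integral_density, simp, simp, intro nn_integral_cong)
      fix x
      \<comment> \<open>Completing the square: weighting by \<open>exp (u * x)\<close> shifts the
        mean to \<open>u\<close> at the cost of the factor
        \<open>exp (u\<^sup>2 / 2)\<close>.\<close>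
      have "- x\<^sup>2 / 2 + u * x = u\<^sup>2 / 2 + (- (x - u)\<^sup>2 / 2)"
        by (simp add: field_simps power2_eq_square)
      then have "std_normal_density x * exp (u * x) = exp (u\<^sup>2 / 2) * normal_density u 1 x"
        by (simp add: normal_density_def flip: exp_add)
      then show "ennreal (std_normal_density x) * ennreal (exp (u * x)) =
          ennreal (exp (u\<^sup>2 / 2)) * ennreal (normal_density u 1 x)"
        by (simp flip: ennreal_mult)
    qed
    also have "\<dots> = ennreal (exp (u\<^sup>2 / 2)) * ennreal (\<integral>x. normal_density u 1 x \<partial>lborel)"
      by (subst nn_integral_cmult) (auto simp: nn_integral_eq_integral)
    also have "\<dots> = ennreal (exp (a * t\<^sup>2 / 2))"
      using assms by (simp add: u_def power_mult_distrib mult.commute)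
    finally show ?thesis .
  qed
  ultimately show ?thesis by (rule that)
qed

lemma le_exp_minus_one [simp]: "x \<le> exp x - 1" for x :: real
  using exp_ge_add_one_self[of x] by linarith

lemma abs_le_one_plus_square: "\<bar>x\<bar> \<le> 1 + x\<^sup>2" for x :: real
  using sum_power2_ge_zero[of "\<bar>x\<bar> - 1" 0] by (simp add: power2_eq_square algebra_simps)

text \<open>A Gaussian law convolved with a compound Poisson law, then shifted by the mean
  \<open>c\<close> of the jump measure. Both transforms are recorded: the characteristic function
  drives the weak limit, the exponential moment is the quantity to be carried through it.\<close>

lemma levy_khintchine_finite:
  fixes a :: real
  assumes a: "0 \<le> a" and fin: "finite_measure \<rho>" and sets_\<rho>[measurable_cong]: "sets \<rho> = sets borel"
    and sq: "integrable \<rho> (\<lambda>x. x\<^sup>2)"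
  obtains D where "real_distribution D"
    "\<And>s. char D s = exp (- of_real (a * s\<^sup>2 / 2) + (CLINT x|\<rho>. iexp (s * x) - 1 - \<i> * of_real (s * x)))"
    "\<And>t. (\<integral>\<^sup>+x. ennreal (exp (t * x)) \<partial>D) =
       ennreal_exp (ennreal (a * t\<^sup>2 / 2) + (\<integral>\<^sup>+x. ennreal (exp (t * x) - 1 - t * x) \<partial>\<rho>))"
proof -
  interpret \<rho>: finite_measure \<rho> by fact
  have sp: "space \<rho> = UNIV" using sets_eq_imp_space_eq[OF sets_\<rho>] by simp
  obtain G where G: "real_distribution G" "\<And>s. char G s = of_real (exp (- (a * s\<^sup>2 / 2)))"
    "\<And>t. (\<integral>\<^sup>+x. ennreal (exp (t * x)) \<partial>G) = ennreal (exp (a * t\<^sup>2 / 2))"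
    using gaussian_law[OF a] by blast
  obtain C where C: "real_distribution C" "\<And>s. char C s = exp (CLINT x|\<rho>. iexp (s * x) - 1)"
    "\<And>t. (\<integral>\<^sup>+x. ennreal (exp (t * x)) \<partial>C) =
       (if (\<integral>\<^sup>+x. ennreal (exp (t * x)) \<partial>\<rho>) = \<infinity> then \<infinity>
        else ennreal (exp (enn2real (\<integral>\<^sup>+x. ennreal (exp (t * x)) \<partial>\<rho>) - measure \<rho> UNIV)))"
    using compound_poisson[OF fin sets_\<rho>] by blast
  \<comment> \<open>As \<rho> is finite, \<open>1 + x\<^sup>2\<close> is integrable; this makes the
    compensator \<open>c\<close> finite.\<close>
  have x_int: "integrable \<rho> (\<lambda>x. x)"
  proof (rule Bochner_Integration.integrable_bound)
    show "integrable \<rho> (\<lambda>x. 1 + x\<^sup>2)" using sq by simp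
    show "AE x in \<rho>. norm x \<le> norm (1 + x\<^sup>2)"
      using abs_le_one_plus_square by (intro AE_I2) (simp add: abs_of_nonneg)
  qed simp
  define c where "c = (\<integral>x. x \<partial>\<rho>)"
  have GC: "real_distribution (G \<star> C)" using G(1) C(1) by (rule real_distribution_convolution)
  interpret GC: real_distribution "G \<star> C" by (rule GC)
  define D where "D = distr (G \<star> C) borel (\<lambda>x. x - c)"
  have "real_distribution D" unfolding D_def by (rule GC.real_distribution_distr) simp
  moreover have "char D s = exp (- of_real (a * s\<^sup>2 / 2) + (CLINT x|\<rho>. iexp (s * x) - 1 - \<i> * of_real (s * x)))" for s
  proof -
    have int: "integrable \<rho> (\<lambda>x. iexp (s * x) - 1)"
      by (intro Bochner_Integration.integrable_diff \<rho>.integrable_const_bound[where B=1]) auto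
    have int': "integrable \<rho> (\<lambda>x. complex_of_real (s * x))"
      using x_int by (intro integrable_of_real) auto
    have "char D s = (CLINT x|G \<star> C. exp (- \<i> * of_real (s * c)) * iexp (s * x))"
      unfolding D_def char_def by (subst integral_distr) (auto simp: algebra_simps simp flip: exp_add)
    also have "\<dots> = exp (- \<i> * of_real (s * c)) * (char G s * char C s)"
      unfolding char_convolution[OF G(1) C(1), symmetric] by (simp add: char_def)
    also have "\<dots> = exp (- of_real (a * s\<^sup>2 / 2) + ((CLINT x|\<rho>. iexp (s * x) - 1) - \<i> * of_real (s * c)))"
      by (simp add: G(2) C(2) exp_of_real[symmetric] mult_exp_exp algebra_simps)
    also have "(CLINT x|\<rho>. iexp (s * x) - 1) - \<i> * of_real (s * c) = (CLINT x|\<rho>. iexp (s * x) - 1 - \<i> * of_real (s * x))"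
    proof -
      have "(CLINT x|\<rho>. \<i> * of_real (s * x)) = \<i> * of_real (s * c)"
        unfolding c_def integral_mult_right_zero integral_complex_of_real ..
      then show ?thesis
        using Bochner_Integration.integral_diff[OF int integrable_mult_right[OF int', of \<i>]]
        by (simp only:)
    qed
    finally show ?thesis .
  qed
  moreover have "(\<integral>\<^sup>+x. ennreal (exp (t * x)) \<partial>D) =
       ennreal_exp (ennreal (a * t\<^sup>2 / 2) + (\<integral>\<^sup>+x. ennreal (exp (t * x) - 1 - t * x) \<partial>\<rho>))" for t
  proof -
    have D: "(\<integral>\<^sup>+x. ennreal (exp (t * x)) \<partial>D) =
        ennreal (exp (- t * c)) * (ennreal (exp (a * t\<^sup>2 / 2)) * (\<integral>\<^sup>+x. ennreal (exp (t * x)) \<partial>C))"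
    proof -
      have "(\<integral>\<^sup>+x. ennreal (exp (t * x)) \<partial>D) = (\<integral>\<^sup>+x. ennreal (exp (- t * c)) * ennreal (exp (t * x)) \<partial>(G \<star> C))"
      proof -
        have "exp (t * (x - c)) = exp (- t * c) * exp (t * x)" for x
          by (simp add: right_diff_distrib flip: exp_add)
        then show ?thesis unfolding D_def by (simp add: nn_integral_distr ennreal_mult)
      qed
      also have "\<dots> = ennreal (exp (- t * c)) * (\<integral>\<^sup>+x. ennreal (exp (t * x)) \<partial>(G \<star> C))"
        by (subst nn_integral_cmult) auto
      finally show ?thesis by (simp add: mgf_convolution[OF G(1) C(1)] G(3))
    qed
    show ?thesis
    proof (cases "(\<integral>\<^sup>+x. ennreal (exp (t * x)) \<partial>\<rho>) = \<infinity>")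
      \<comment> \<open>Here \<open>exp (t * x)\<close> exceeds the compensated integrand by at most
        \<open>\<bar>1 + t * x\<bar>\<close>, which is integrable, so the compensated integral
        diverges as well.\<close>
      case True
      have "(\<integral>\<^sup>+x. ennreal (exp (t * x)) \<partial>\<rho>) \<le>
          (\<integral>\<^sup>+x. ennreal (exp (t * x) - 1 - t * x) + ennreal \<bar>1 + t * x\<bar> \<partial>\<rho>)"
        proof (rule nn_integral_mono)
          fix x
          have "exp (t * x) \<le> (exp (t * x) - 1 - t * x) + \<bar>1 + t * x\<bar>" by linarith
          then have "ennreal (exp (t * x)) \<le> ennreal ((exp (t * x) - 1 - t * x) + \<bar>1 + t * x\<bar>)"
            by (rule ennreal_leI)
          then show "ennreal (exp (t * x)) \<le> ennreal (exp (t * x) - 1 - t * x) + ennreal \<bar>1 + t * x\<bar>"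
            by (subst (asm) ennreal_plus) simp_all
        qed
      also have "\<dots> = (\<integral>\<^sup>+x. ennreal (exp (t * x) - 1 - t * x) \<partial>\<rho>) + (\<integral>\<^sup>+x. ennreal \<bar>1 + t * x\<bar> \<partial>\<rho>)"
        by (intro nn_integral_add) auto
      finally have "(\<integral>\<^sup>+x. ennreal (exp (t * x) - 1 - t * x) \<partial>\<rho>) + (\<integral>\<^sup>+x. ennreal \<bar>1 + t * x\<bar> \<partial>\<rho>) = \<infinity>"
        using True by (simp add: top_unique)
      moreover have "integrable \<rho> (\<lambda>x. 1 + t * x)" using x_int by simp
      then have "(\<integral>\<^sup>+x. ennreal \<bar>1 + t * x\<bar> \<partial>\<rho>) \<noteq> \<infinity>"
        by (auto simp: integrable_iff_bounded)
      ultimately have "(\<integral>\<^sup>+x. ennreal (exp (t * x) - 1 - t * x) \<partial>\<rho>) = \<infinity>"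
        by simp
      then show ?thesis using True by (simp add: D C(3) ennreal_mult_top)
    next
      case False
      then have e_int: "integrable \<rho> (\<lambda>x. exp (t * x))"
        by (intro integrableI_bounded) (auto simp: top.not_eq_extremum)
      have 1: "(\<integral>\<^sup>+x. ennreal (exp (t * x)) \<partial>\<rho>) = ennreal (\<integral>x. exp (t * x) \<partial>\<rho>)"
        using e_int by (intro nn_integral_eq_integral) auto
      define J where "J = (\<integral>x. exp (t * x) - 1 - t * x \<partial>\<rho>)"
      have J: "(\<integral>\<^sup>+x. ennreal (exp (t * x) - 1 - t * x) \<partial>\<rho>) = ennreal J"
        unfolding J_def using e_int x_int by (intro nn_integral_eq_integral) auto
      have J_eq: "J = (\<integral>x. exp (t * x) \<partial>\<rho>) - measure \<rho> UNIV - t * c"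
        unfolding J_def using e_int x_int by (simp add: c_def sp)
      have J_nonneg: "0 \<le> J"
        unfolding J_def by (intro Bochner_Integration.integral_nonneg) simp
      have I_nonneg: "0 \<le> (\<integral>x. exp (t * x) \<partial>\<rho>)"
        by (intro Bochner_Integration.integral_nonneg) simp
      have "(\<integral>\<^sup>+x. ennreal (exp (t * x)) \<partial>D) =
          ennreal (exp (- t * c) * (exp (a * t\<^sup>2 / 2) * exp ((\<integral>x. exp (t * x) \<partial>\<rho>) - measure \<rho> UNIV)))"
        unfolding D C(3) 1 using I_nonneg by (simp add: ennreal_mult)
      also have "exp (- t * c) * (exp (a * t\<^sup>2 / 2) * exp ((\<integral>x. exp (t * x) \<partial>\<rho>) - measure \<rho> UNIV)) =
          exp (a * t\<^sup>2 / 2 + J)"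
        unfolding J_eq mult_exp_exp by (simp add: algebra_simps)
      also have "ennreal \<dots> = ennreal_exp (ennreal (a * t\<^sup>2 / 2) + ennreal J)"
        using J_nonneg a by (simp add: ennreal_exp_ennreal flip: ennreal_plus)
      finally show ?thesis unfolding J .
    qed
  qed
  ultimately show ?thesis by (rule that)
qed

section \<open>Truncation of exponential moments\<close>

lemma ennreal_exp_leD:
  assumes "ennreal_exp x \<le> ennreal y"
  shows "1 \<le> y" "x \<le> ennreal (ln y)"
proof -
  obtain r where r: "x = ennreal r" "0 \<le> r"
    using assms by (cases x) (auto simp: top_unique)
  have "exp r \<le> y"
    using assms r by (simp add: ennreal_exp_ennreal ennreal_le_iff2 not_le)
  moreover have "1 \<le> exp r" using r by simp
  ultimately show "1 \<le> y" by linarith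
  have "r \<le> ln y" using \<open>exp r \<le> y\<close> \<open>1 \<le> y\<close> by (simp add: ln_ge_iff)
  then show "x \<le> ennreal (ln y)" by (simp add: r ennreal_leI)
qed

text \<open>For finite \<open>y\<close> each \<open>f n\<close> is at most \<open>ln y\<close>,
  hence so is the supremum. This is how \<open>ennreal_exp\<close> is brought past the limit in
  which the small jumps are restored.\<close>

lemma ennreal_exp_SUP_le:
  assumes le: "\<And>n::nat. ennreal_exp (f n) \<le> y"
  shows "ennreal_exp (SUP n. f n) \<le> y"
proof (cases y)
  case (real r)
  have "(SUP n. f n) \<le> ennreal (ln r)"
    using ennreal_exp_leD(2) le real by (intro SUP_least) auto
  then have "ennreal_exp (SUP n. f n) \<le> ennreal_exp (ennreal (ln r))"
    by (rule ennreal_exp_mono)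
  also have "\<dots> = ennreal r"
    using ennreal_exp_leD(1)[of "f 0" r] le[of 0] real by (subst ennreal_exp_ennreal) auto
  finally show ?thesis using real by simp
qed simp

text \<open>The mean of \<open>exp (b * z)\<close> under the Beta law is at most
  \<open>exp \<bar>z\<bar>\<close>.\<close>

lemma exp_remainder_le: "exp z - 1 - z \<le> z\<^sup>2 / 2 * exp \<bar>z\<bar>" for z :: real
proof -
  have "(\<integral>\<^sup>+b. ennreal (exp (b * z)) \<partial>beta_law) \<le> (\<integral>\<^sup>+b. ennreal (exp \<bar>z\<bar>) \<partial>beta_law)"
  proof (rule nn_integral_mono_AE)
    show "AE b in beta_law. ennreal (exp (b * z)) \<le> ennreal (exp \<bar>z\<bar>)"
      using AE_beta_law
    proof eventually_elim
      case (elim b)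
      have "b * z \<le> \<bar>b * z\<bar>" by simp
      also have "\<dots> \<le> \<bar>z\<bar>" using elim by (simp add: abs_mult mult_left_le_one_le)
      finally show ?case by (simp add: ennreal_leI)
    qed
  qed
  also have "\<dots> = ennreal (exp \<bar>z\<bar>)" using beta_law.emeasure_space_1 by simp
  finally have "ennreal (exp z - 1 - z) \<le> ennreal (z\<^sup>2 / 2) * ennreal (exp \<bar>z\<bar>)"
    unfolding nn_integral_exp_beta_law[symmetric] by (rule mult_left_mono) simp
  also have "\<dots> = ennreal (z\<^sup>2 / 2 * exp \<bar>z\<bar>)" by (rule ennreal_mult[symmetric]) auto
  finally show ?thesis by (subst (asm) ennreal_le_iff) auto
qed

text \<open>Monotone convergence: bounded tests determine the exponential moment even when it is
  infinite.\<close>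

lemma SUP_nn_integral_min_exp:
  assumes [measurable_cong]: "sets D = sets borel"
  shows "(SUP n. \<integral>\<^sup>+x. ennreal (min (exp (t * x)) (real n)) \<partial>D) = (\<integral>\<^sup>+x. ennreal (exp (t * x)) \<partial>D)"
proof -
  have "(SUP n. \<integral>\<^sup>+x. ennreal (min (exp (t * x)) (real n)) \<partial>D) =
      (\<integral>\<^sup>+x. (SUP n. ennreal (min (exp (t * x)) (real n))) \<partial>D)"
    by (rule nn_integral_monotone_convergence_SUP[symmetric])
       (auto simp: incseq_def le_fun_def intro!: ennreal_leI)
  also have "(\<lambda>x. SUP n. ennreal (min (exp (t * x)) (real n))) = (\<lambda>x. ennreal (exp (t * x)))"
  proof (intro ext antisym)
    fix x
    define v where "v = exp (t * x)"
    have sup: "ennreal v \<le> (SUP n. ennreal (min v (real n)))"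
    proof -
      obtain n where "v \<le> real n" using real_arch_simple by blast
      then show ?thesis by (intro SUP_upper2[of n]) auto
    qed
    then show "ennreal (exp (t * x)) \<le> (SUP n. ennreal (min (exp (t * x)) (real n)))"
      by (simp only: v_def)
    show "(SUP n. ennreal (min (exp (t * x)) (real n))) \<le> ennreal (exp (t * x))"
      by (intro SUP_least ennreal_leI) auto
  qed
  finally show ?thesis .
qed

text \<open>Uniform integrability in quantitative form:
  \<open>v \<le> min v K + v\<^sup>2 / K\<close> with \<open>v = exp (t * x)\<close>. The square is
  the source of the order \<open>2 * t\<close>.\<close>

lemma nn_integral_min_exp_ge:
  assumes [measurable_cong]: "sets D = sets borel" and K: "0 < K"
  shows "(\<integral>\<^sup>+x. ennreal (exp (t * x)) \<partial>D) \<le>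
    (\<integral>\<^sup>+x. ennreal (min (exp (t * x)) K) \<partial>D) + ennreal (1 / K) * (\<integral>\<^sup>+x. ennreal (exp (2 * t * x)) \<partial>D)"
proof -
  have le: "v \<le> min v K + v\<^sup>2 / K" if "0 \<le> v" for v
  proof (cases "v \<le> K")
    case False
    then have "v * K \<le> v * v" using that by (intro mult_left_mono) auto
    then have "v \<le> v\<^sup>2 / K" using K by (simp add: field_simps power2_eq_square)
    then show ?thesis using K False by simp
  qed (use K in simp)
  have "(\<integral>\<^sup>+x. ennreal (exp (t * x)) \<partial>D) \<le>
      (\<integral>\<^sup>+x. ennreal (min (exp (t * x)) K) + ennreal (1 / K) * ennreal (exp (2 * t * x)) \<partial>D)"
  proof (rule nn_integral_mono)
    fix x
    have "(exp (t * x))\<^sup>2 = exp (2 * t * x)" by (simp add: exp_double[symmetric] mult.assoc)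
    then have "exp (t * x) \<le> min (exp (t * x)) K + 1 / K * exp (2 * t * x)"
      using le[of "exp (t * x)"] by simp
    then have "ennreal (exp (t * x)) \<le> ennreal (min (exp (t * x)) K + 1 / K * exp (2 * t * x))"
      by (rule ennreal_leI)
    also have "\<dots> = ennreal (min (exp (t * x)) K) + ennreal (1 / K) * ennreal (exp (2 * t * x))"
      using K by (simp flip: ennreal_mult)
    finally show "ennreal (exp (t * x)) \<le> ennreal (min (exp (t * x)) K) + ennreal (1 / K) * ennreal (exp (2 * t * x))" .
  qed
  also have "\<dots> = (\<integral>\<^sup>+x. ennreal (min (exp (t * x)) K) \<partial>D) + ennreal (1 / K) * (\<integral>\<^sup>+x. ennreal (exp (2 * t * x)) \<partial>D)"
    by (simp add: nn_integral_add nn_integral_cmult)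
  finally show ?thesis .
qed

text \<open>Rests on \<open>min u K * min v K' \<le> min (u * v) (K * K')\<close>: truncation levels
  multiply, so the two factors can be truncated at different heights.\<close>

lemma nn_integral_min_exp_convolution_ge:
  assumes D: "real_distribution D" and E: "real_distribution E" and "0 \<le> K" "0 \<le> K'"
  shows "(\<integral>\<^sup>+x. ennreal (min (exp (t * x)) K) \<partial>D) * (\<integral>\<^sup>+x. ennreal (min (exp (t * x)) K') \<partial>E) \<le>
    (\<integral>\<^sup>+x. ennreal (min (exp (t * x)) (K * K')) \<partial>(D \<star> E))"
proof -
  interpret D: real_distribution D by fact
  interpret E: real_distribution E by fact
  have "(\<integral>\<^sup>+x. ennreal (min (exp (t * x)) K) \<partial>D) * (\<integral>\<^sup>+x. ennreal (min (exp (t * x)) K') \<partial>E) =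
      (\<integral>\<^sup>+x. \<integral>\<^sup>+y. ennreal (min (exp (t * x)) K) * ennreal (min (exp (t * y)) K') \<partial>E \<partial>D)"
    by (simp add: nn_integral_cmult nn_integral_multc)
  also have "\<dots> \<le> (\<integral>\<^sup>+x. \<integral>\<^sup>+y. ennreal (min (exp (t * (x + y))) (K * K')) \<partial>E \<partial>D)"
  proof (intro nn_integral_mono)
    fix x y
    have "min (exp (t * x)) K * min (exp (t * y)) K' \<le> exp (t * x) * exp (t * y)"
      using assms by (intro mult_mono) auto
    moreover have "min (exp (t * x)) K * min (exp (t * y)) K' \<le> K * K'"
      using assms by (intro mult_mono) auto
    ultimately have "min (exp (t * x)) K * min (exp (t * y)) K' \<le> min (exp (t * (x + y))) (K * K')"
      by (simp add: distrib_left exp_add)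
    then show "ennreal (min (exp (t * x)) K) * ennreal (min (exp (t * y)) K') \<le>
        ennreal (min (exp (t * (x + y))) (K * K'))"
      using assms by (simp add: ennreal_leI flip: ennreal_mult)
  qed
  also have "\<dots> = (\<integral>\<^sup>+x. ennreal (min (exp (t * x)) (K * K')) \<partial>(D \<star> E))"
    by (subst nn_integral_convolution) (auto intro: D.finite_measure_axioms E.finite_measure_axioms)
  finally show ?thesis .
qed

lemma weak_conv_nn_integral_min_exp:
  assumes "\<And>n. real_distribution (D n)" "real_distribution E" "weak_conv_m D E" and K: "0 \<le> K"
  shows "(\<lambda>n. \<integral>\<^sup>+x. ennreal (min (exp (t * x)) K) \<partial>(D n)) \<longlonglongrightarrow> (\<integral>\<^sup>+x. ennreal (min (exp (t * x)) K) \<partial>E)"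
proof -
  have eq: "(\<integral>\<^sup>+x. ennreal (min (exp (t * x)) K) \<partial>F) = ennreal (\<integral>x. min (exp (t * x)) K \<partial>F)"
    if "real_distribution F" for F
  proof -
    interpret F: real_distribution F by fact
    have "integrable F (\<lambda>x. min (exp (t * x)) K)"
      using K by (intro F.integrable_const_bound[where B=K]) auto
    then show ?thesis using K by (intro nn_integral_eq_integral) auto
  qed
  have "(\<lambda>n. \<integral>x. min (exp (t * x)) K \<partial>(D n)) \<longlonglongrightarrow> (\<integral>x. min (exp (t * x)) K \<partial>E)"
    using assms by (intro weak_conv_imp_integral_bdd_continuous_conv[where B=K])
      (auto intro!: continuous_intros)
  then show ?thesis by (simp add: eq assms tendsto_ennrealI)
qed

section \<open>Restrictions of the Levy measure and bounds for the exponents\<close>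

context canonical_law
begin

text \<open>Encoded as a density, so that it stays a Borel measure on the whole line, as
  \<open>levy_khintchine_finite\<close> requires.\<close>

definition restricted :: "real set \<Rightarrow> real measure" where
  "restricted B = density \<nu> (\<lambda>x. ennreal (indicator B x))"

lemma sets_restricted [simp, measurable_cong]: "sets (restricted B) = sets borel"
  by (simp add: restricted_def)

lemma nn_integral_restricted:
  assumes [measurable]: "B \<in> sets borel" "f \<in> borel_measurable borel"
  shows "(\<integral>\<^sup>+x. f x \<partial>restricted B) = (\<integral>\<^sup>+x. f x * indicator B x \<partial>\<nu>)"
  by (simp add: restricted_def nn_integral_density mult.commute ennreal_indicator)

lemma integral_restricted:
  fixes f :: "real \<Rightarrow> complex"
  assumes [measurable]: "B \<in> sets borel" "f \<in> borel_measurable borel"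
  shows "(\<integral>x. f x \<partial>restricted B) = (\<integral>x. indicator B x *\<^sub>R f x \<partial>\<nu>)"
  by (simp add: restricted_def integral_density)

text \<open>On \<open>B\<close> the constant 1 is at most
  \<open>x\<^sup>2 / e\<^sup>2\<close>.\<close>

lemma finite_measure_restricted:
  assumes [measurable]: "B \<in> sets borel" and e: "0 < e" and B: "\<And>x. x \<in> B \<Longrightarrow> e \<le> \<bar>x\<bar>"
  shows "finite_measure (restricted B)"
proof
  have le: "indicator B x \<le> 1 / e\<^sup>2 * x\<^sup>2" for x :: real
  proof (cases "x \<in> B")
    case True
    then have "e\<^sup>2 \<le> \<bar>x\<bar>\<^sup>2" using B e by (intro power_mono) auto
    then show ?thesis using e True by (simp add: field_simps)
  qed simp
  have "integrable \<nu> (indicator B :: real \<Rightarrow> real)"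
    using le by (intro integrable_\<nu>_bounded_square[where C = "1 / e\<^sup>2"]) auto
  then have "emeasure \<nu> B < \<infinity>" by (simp add: integrable_indicator_iff)
  moreover have "emeasure (restricted B) (space (restricted B)) = emeasure \<nu> B"
    using nn_integral_restricted[of B "\<lambda>_. 1"] by (simp add: restricted_def)
  ultimately show "emeasure (restricted B) (space (restricted B)) \<noteq> \<infinity>" by auto
qed

lemma integrable_restricted_square:
  assumes [measurable]: "B \<in> sets borel"
  shows "integrable (restricted B) (\<lambda>x. x\<^sup>2)"
  unfolding restricted_def
  by (subst integrable_density) (auto intro!: integrable_\<nu>_bounded_square[where C=1] split: split_indicator)

lemma iexp_remainder_bound: "norm (iexp (s * x) - 1 - \<i> * of_real (s * x)) \<le> s\<^sup>2 / 2 * x\<^sup>2"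
  using iexp_approx1[of "s * x" 1] by (simp add: diff_diff_eq eval_nat_numeral mult_ac)

lemma integrable_iexp_remainder: "integrable \<nu> (\<lambda>x. iexp (s * x) - 1 - \<i> * of_real (s * x))"
  by (rule integrable_\<nu>_bounded_square[OF _ iexp_remainder_bound]) measurable

text \<open>For jumps in [-1, 1] the Taylor bound is at most
  \<open>t\<^sup>2 / 2 * exp \<bar>t\<bar>\<close> times x^2. This bounds the exponential moments of
  all small-jump laws simultaneously.\<close>

lemma nn_integral_exp_remainder_finite:
  "(\<integral>\<^sup>+x. ennreal (exp (t * x) - 1 - t * x) * indicator {-1..1} x \<partial>\<nu>) < \<infinity>"
proof -
  define C where "C = t\<^sup>2 / 2 * exp \<bar>t\<bar>"
  have "(exp (t * x) - 1 - t * x) * indicator {-1..1} x \<le> C * x\<^sup>2" for x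
  proof (cases "x \<in> {-1..1}")
    case True
    then have "\<bar>t * x\<bar> \<le> \<bar>t\<bar>" by (auto simp: abs_mult intro!: mult_left_le)
    then have "(t * x)\<^sup>2 / 2 * exp \<bar>t * x\<bar> \<le> (t * x)\<^sup>2 / 2 * exp \<bar>t\<bar>"
      by (intro mult_left_mono) auto
    then show ?thesis
      using True exp_remainder_le[of "t * x"] by (simp add: C_def power_mult_distrib mult_ac)
  qed (simp add: C_def)
  moreover have "0 \<le> (exp (t * x) - 1 - t * x) * indicator {-1..1} x" for x
    by simp
  ultimately have "integrable \<nu> (\<lambda>x. (exp (t * x) - 1 - t * x) * indicator {-1..1} x)"
    by (intro integrable_\<nu>_bounded_square[where C=C]) auto
  then have "(\<integral>\<^sup>+x. ennreal (norm ((exp (t * x) - 1 - t * x) * indicator {-1..1} x)) \<partial>\<nu>) < \<infinity>"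
    by (simp add: integrable_iff_bounded)
  also have "(\<integral>\<^sup>+x. ennreal (norm ((exp (t * x) - 1 - t * x) * indicator {-1..1} x)) \<partial>\<nu>) =
      (\<integral>\<^sup>+x. ennreal (exp (t * x) - 1 - t * x) * indicator {-1..1} x \<partial>\<nu>)"
    by (intro nn_integral_cong) (auto split: split_indicator)
  finally show ?thesis .
qed

end

section \<open>The moment generating function of an infinitely divisible law\<close>

context canonical_law
begin

text \<open>The approximants are \<open>A \<star> W m\<close>: \<open>A\<close> has the Gaussian
  part and the large jumps and may have infinite exponential moments, while \<open>W m\<close> has
  the jumps of modulus between \<open>1 / (m + 1)\<close> and 1. Truncated tests pass to the weak
  limit and yield \<open>upper\<close> and \<open>lower\<close>.\<close>

lemma mgf_infinitely_divisible:
  assumes \<mu>: "real_distribution \<mu>"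
    and char_\<mu>: "\<And>s. char \<mu> s = exp (- of_real (a * s\<^sup>2 / 2) + (CLINT x|\<nu>. iexp (s * x) - 1 - \<i> * of_real (s * x)))"
  shows "(\<integral>\<^sup>+x. ennreal (exp (t * x)) \<partial>\<mu>) =
    ennreal_exp (ennreal (a * t\<^sup>2 / 2) + (\<integral>\<^sup>+x. ennreal (exp (t * x) - 1 - t * x) \<partial>\<nu>))"
proof -
  interpret \<mu>: real_distribution \<mu> by fact
  define L where "L = {x::real. 1 < \<bar>x\<bar>}"
  define S where "S m = {x::real. inverse (real (Suc m)) < \<bar>x\<bar> \<and> \<bar>x\<bar> \<le> 1}" for m
  have [measurable]: "L \<in> sets borel" unfolding L_def by measurable
  have [measurable]: "S m \<in> sets borel" for m unfolding S_def by measurable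
  have S_mono: "S m \<subseteq> S n" if "m \<le> n" for m n
  proof
    fix x assume "x \<in> S m"
    moreover have "inverse (real (Suc n)) \<le> inverse (real (Suc m))"
      using that by (intro le_imp_inverse_le) auto
    ultimately show "x \<in> S n" unfolding S_def mem_Collect_eq by linarith
  qed
  have fin: "finite_measure (restricted L)" "finite_measure (restricted (S m))" for m
    by (rule finite_measure_restricted[of _ 1], auto simp: L_def)
       (rule finite_measure_restricted[of _ "inverse (real (Suc m))"], auto simp: S_def)
  define J where "J t B = (\<integral>\<^sup>+x. ennreal (exp (t * x) - 1 - t * x) * indicator B x \<partial>\<nu>)" for t B
  define \<psi> where "\<psi> s B = (CLINT x|\<nu>. indicator B x *\<^sub>R (iexp (s * x) - 1 - \<i> * of_real (s * x)))" for s and B :: "real set"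
  define mgf' where "mgf' t D = (\<integral>\<^sup>+x. ennreal (exp (t * x)) \<partial>D)" for t and D :: "real measure"
  define mgfK where "mgfK K D = (\<integral>\<^sup>+x. ennreal (min (exp (t * x)) K) \<partial>D)" for K and D :: "real measure"
  obtain A where A: "real_distribution A" "\<And>s. char A s = exp (- of_real (a * s\<^sup>2 / 2) + \<psi> s L)"
      "\<And>t. mgf' t A = ennreal_exp (ennreal (a * t\<^sup>2 / 2) + J t L)"
    using levy_khintchine_finite[OF a_nonneg fin(1) sets_restricted integrable_restricted_square]
    unfolding \<psi>_def J_def mgf'_def by (auto simp: integral_restricted nn_integral_restricted)
  have "\<exists>W. real_distribution W \<and> (\<forall>s. char W s = exp (\<psi> s (S m))) \<and> (\<forall>t. mgf' t W = ennreal_exp (J t (S m)))" for m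
  proof -
    have "S m \<in> sets borel" by measurable
    from levy_khintchine_finite[OF order_refl fin(2)[of m] sets_restricted integrable_restricted_square[OF this]]
    obtain D where "real_distribution D"
      "\<And>s. char D s = exp (- of_real (0 * s\<^sup>2 / 2) + (CLINT x|restricted (S m). iexp (s * x) - 1 - \<i> * of_real (s * x)))"
      "\<And>t. (\<integral>\<^sup>+x. ennreal (exp (t * x)) \<partial>D) =
        ennreal_exp (ennreal (0 * t\<^sup>2 / 2) + (\<integral>\<^sup>+x. ennreal (exp (t * x) - 1 - t * x) \<partial>restricted (S m)))"
      by blast
    then show ?thesis
      unfolding \<psi>_def J_def mgf'_def by (intro exI[of _ D]) (simp add: integral_restricted nn_integral_restricted)
  qed
  then obtain W where W: "\<And>m. real_distribution (W m)" "\<And>m s. char (W m) s = exp (\<psi> s (S m))"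
      "\<And>m t. mgf' t (W m) = ennreal_exp (J t (S m))"
    by metis
  define X where "X m = (A \<star> W m)" for m
  have X: "real_distribution (X m)" for m
    unfolding X_def by (intro real_distribution_convolution A W)

  have J_mono: "J t B \<le> J t C" if "B \<subseteq> C" for t B C
    unfolding J_def using that by (intro nn_integral_mono mult_left_mono) (auto split: split_indicator)
  have J_add: "J t L + J t (S m) = J t (L \<union> S m)" for t m
    unfolding J_def by (subst nn_integral_add[symmetric])
      (auto intro!: nn_integral_cong simp: L_def S_def split: split_indicator)
  have mgf_X: "mgf' t (X m) = ennreal_exp (ennreal (a * t\<^sup>2 / 2) + J t (L \<union> S m))" for t m
    unfolding X_def using mgf_convolution[OF A(1) W(1)[of m], of t] A(3)[of t] W(3)[of t m]
    by (simp add: mgf'_def ennreal_exp_add[symmetric] J_add[symmetric] add.assoc)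

  \<comment> \<open>\<open>L \<union> S m\<close> exhausts the line without the origin, so the
    exponents converge by dominated convergence and Levy's continuity theorem applies.\<close>
  have "weak_conv_m X \<mu>"
  proof (rule levy_continuity[OF X \<mu>])
    fix s
    define f where "f x = iexp (s * x) - 1 - \<i> * complex_of_real (s * x)" for x :: real
    have [measurable]: "f \<in> borel_measurable borel" unfolding f_def by measurable
    have f_int: "integrable \<nu> f" unfolding f_def by (rule integrable_iexp_remainder)
    have int: "integrable \<nu> (\<lambda>x. indicator B x *\<^sub>R f x)" if "B \<in> sets borel" for B
      using that f_int by (intro integrable_mult_indicator) auto
    have add: "\<psi> s L + \<psi> s (S m) = \<psi> s (L \<union> S m)" for m
      unfolding \<psi>_def f_def[symmetric]
      by (subst Bochner_Integration.integral_add[symmetric])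
         (auto intro!: int Bochner_Integration.integral_cong simp: L_def S_def split: split_indicator)
    have "(\<lambda>m. \<psi> s (L \<union> S m)) \<longlonglongrightarrow> (CLINT x|\<nu>. f x)"
      unfolding \<psi>_def f_def[symmetric]
    proof (rule integral_dominated_convergence[where w = "\<lambda>x. norm (f x)"])
      show "AE x in \<nu>. (\<lambda>m. indicator (L \<union> S m) x *\<^sub>R f x) \<longlonglongrightarrow> f x"
        using AE_\<nu>_nonzero
      proof eventually_elim
        case (elim x)
        have "(\<lambda>m. inverse (real (Suc m))) \<longlonglongrightarrow> 0" by (rule LIMSEQ_inverse_real_of_nat)
        then have "\<forall>\<^sub>F m in sequentially. inverse (real (Suc m)) < \<bar>x\<bar>"
          using elim by (intro order_tendstoD) auto
        then have "\<forall>\<^sub>F m in sequentially. indicator (L \<union> S m) x *\<^sub>R f x = f x"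
          by eventually_elim (auto simp: L_def S_def indicator_def)
        then show ?case by (rule tendsto_eventually)
      qed
      show "AE x in \<nu>. norm (indicator (L \<union> S m) x *\<^sub>R f x) \<le> norm (f x)" for m
        by (intro AE_I2) (auto split: split_indicator)
    qed (use f_int in auto)
    then have "(\<lambda>m. exp (- of_real (a * s\<^sup>2 / 2) + \<psi> s (L \<union> S m))) \<longlonglongrightarrow> exp (- of_real (a * s\<^sup>2 / 2) + (CLINT x|\<nu>. f x))"
      by (intro tendsto_intros)
    moreover have "char (X m) s = exp (- of_real (a * s\<^sup>2 / 2) + \<psi> s (L \<union> S m))" for m
      by (simp add: X_def char_convolution A W mult_exp_exp add[symmetric] algebra_simps)
    ultimately show "(\<lambda>m. char (X m) s) \<longlonglongrightarrow> char \<mu> s"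
      by (simp add: char_\<mu> f_def)
  qed
  then have conv: "(\<lambda>m. mgfK K (X m)) \<longlonglongrightarrow> mgfK K \<mu>" if "0 \<le> K" for K
    unfolding mgfK_def using X \<mu> that by (intro weak_conv_nn_integral_min_exp) auto

  have mgfK_le: "mgfK K D \<le> mgf' t D" for K D
    unfolding mgfK_def mgf'_def by (intro nn_integral_mono ennreal_leI) auto
  have SUP_mgfK: "(SUP n. mgfK (real n) D) = mgf' t D" if "real_distribution D" for D
    unfolding mgfK_def mgf'_def using that
    by (intro SUP_nn_integral_min_exp) (simp add: real_distribution.events_eq_borel)

  have J_total: "(SUP m. J t (L \<union> S m)) = J t UNIV"
  proof -
    have "(SUP m. J t (L \<union> S m)) = (\<integral>\<^sup>+x. (SUP m. ennreal (exp (t * x) - 1 - t * x) * indicator (L \<union> S m) x) \<partial>\<nu>)"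
      unfolding J_def
    proof (rule nn_integral_monotone_convergence_SUP[symmetric])
      show "incseq (\<lambda>m x. ennreal (exp (t * x) - 1 - t * x) * indicator (L \<union> S m) x)"
        using S_mono by (intro incseq_def[THEN iffD2] allI impI le_funI mult_left_mono) (auto simp: indicator_def)
    qed auto
    also have "\<dots> = J t UNIV"
      unfolding J_def
    proof (rule nn_integral_cong_AE)
      show "AE x in \<nu>. (SUP m. ennreal (exp (t * x) - 1 - t * x) * indicator (L \<union> S m) x) =
          ennreal (exp (t * x) - 1 - t * x) * indicator UNIV x"
        using AE_\<nu>_nonzero
      proof eventually_elim
        case (elim x)
        obtain m where "inverse (real (Suc m)) < \<bar>x\<bar>" using reals_Archimedean[of "\<bar>x\<bar>"] elim by auto
        then have m: "indicator (L \<union> S m) x = (1 :: ennreal)" by (auto simp: L_def S_def indicator_def)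
        show ?case
        proof (rule antisym)
          show "(SUP m. ennreal (exp (t * x) - 1 - t * x) * indicator (L \<union> S m) x) \<le>
              ennreal (exp (t * x) - 1 - t * x) * indicator UNIV x"
            by (intro SUP_least mult_left_mono) (auto simp: indicator_def)
          show "ennreal (exp (t * x) - 1 - t * x) * indicator UNIV x \<le>
              (SUP m. ennreal (exp (t * x) - 1 - t * x) * indicator (L \<union> S m) x)"
            using m by (intro SUP_upper2[of m]) auto
        qed
      qed
    qed
    finally show ?thesis .
  qed

  \<comment> \<open>The bound on \<open>X m\<close> is independent of \<open>m\<close>, so it
    survives the weak limit of each truncated test.\<close>
  have upper: "mgf' t \<mu> \<le> ennreal_exp (ennreal (a * t\<^sup>2 / 2) + J t UNIV)"
    unfolding SUP_mgfK[OF \<mu>, symmetric]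
  proof (rule SUP_least)
    fix n :: nat
    have "mgfK (real n) (X m) \<le> ennreal_exp (ennreal (a * t\<^sup>2 / 2) + J t UNIV)" for m
      using mgfK_le[of "real n" "X m"] unfolding mgf_X
      by (rule order_trans) (intro ennreal_exp_mono add_left_mono J_mono, auto)
    then show "mgfK (real n) \<mu> \<le> ennreal_exp (ennreal (a * t\<^sup>2 / 2) + J t UNIV)"
      by (intro LIMSEQ_le_const2[OF conv]) auto
  qed

  have lower: "ennreal_exp (ennreal (a * t\<^sup>2 / 2) + J t (L \<union> S m)) \<le> mgf' t \<mu>" for m
  proof -
    \<comment> \<open>\<open>c\<close> bounds the exponential moments of order \<open>2 * t\<close>
      of all \<open>W m'\<close> at once, because every \<open>S m'\<close> lies in [-1, 1].\<close>
    obtain c where c: "0 \<le> c" "ennreal_exp (J (2 * t) {-1..1}) = ennreal c"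
    proof -
      obtain j where "J (2 * t) {-1..1} = ennreal j" "0 \<le> j"
        using nn_integral_exp_remainder_finite[of "2 * t"] unfolding J_def[symmetric]
        by (cases "J (2 * t) {-1..1}") auto
      then show ?thesis by (intro that[of "exp j"]) (auto simp: ennreal_exp_ennreal)
    qed
    \<comment> \<open>\<open>m\<close> stays fixed on the left while \<open>m'\<close> tends to
      infinity on the right. \<open>A\<close> is truncated at \<open>n\<close> and
      \<open>W m'\<close> at \<open>k\<close>, hence the convolution at \<open>n * k\<close>; the
      truncation error of \<open>W m'\<close> is at most \<open>c / k\<close> and gets multiplied by
      at most \<open>n\<close>.\<close>
    have step: "mgfK (real n) A * ennreal_exp (J t (S m)) \<le> mgf' t \<mu> + ennreal (real n * c / k)"
      if k: "0 < k" for n :: nat and k :: real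
    proof -
      have "mgfK (real n) A * ennreal_exp (J t (S m)) \<le> mgfK (real n * k) (X m') + ennreal (real n * c / k)"
        if m': "m \<le> m'" for m'
      proof -
        have "ennreal_exp (J t (S m)) \<le> mgf' t (W m')"
          unfolding W(3) by (intro S_mono m' ennreal_exp_mono J_mono)
        also have "\<dots> \<le> mgfK k (W m') + ennreal (1 / k) * mgf' (2 * t) (W m')"
          unfolding mgf'_def mgfK_def
          by (rule nn_integral_min_exp_ge[OF _ k]) (simp add: real_distribution.events_eq_borel W(1))
        also have "mgf' (2 * t) (W m') \<le> ennreal c"
          unfolding W(3) c(2)[symmetric] by (intro ennreal_exp_mono J_mono) (auto simp: S_def)
        then have "mgfK k (W m') + ennreal (1 / k) * mgf' (2 * t) (W m') \<le> mgfK k (W m') + ennreal (1 / k) * ennreal c"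
          by (intro add_left_mono mult_left_mono) auto
        finally have "mgfK (real n) A * ennreal_exp (J t (S m)) \<le>
            mgfK (real n) A * (mgfK k (W m') + ennreal (1 / k) * ennreal c)"
          by (intro mult_left_mono) auto
        also have "\<dots> = mgfK (real n) A * mgfK k (W m') + mgfK (real n) A * (ennreal (1 / k) * ennreal c)"
          by (rule distrib_left)
        also have "\<dots> \<le> mgfK (real n * k) (X m') + ennreal (real n) * (ennreal (1 / k) * ennreal c)"
        proof (intro add_mono mult_right_mono)
          show "mgfK (real n) A * mgfK k (W m') \<le> mgfK (real n * k) (X m')"
            unfolding mgfK_def X_def using k by (intro nn_integral_min_exp_convolution_ge A W) auto
          interpret A: real_distribution A by (rule A(1))
          have "mgfK (real n) A \<le> (\<integral>\<^sup>+x. ennreal (real n) \<partial>A)"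
            unfolding mgfK_def by (intro nn_integral_mono ennreal_leI) auto
          then show "mgfK (real n) A \<le> ennreal (real n)"
            using A.emeasure_space_1 by simp
        qed auto
        also have "ennreal (real n) * (ennreal (1 / k) * ennreal c) = ennreal (real n * c / k)"
          using k c(1) by (simp flip: ennreal_mult)
        finally show ?thesis .
      qed
      then have "mgfK (real n) A * ennreal_exp (J t (S m)) \<le> mgfK (real n * k) \<mu> + ennreal (real n * c / k)"
        using k by (intro LIMSEQ_le_const[OF tendsto_add[OF conv tendsto_const]]) auto
      also have "\<dots> \<le> mgf' t \<mu> + ennreal (real n * c / k)"
        by (intro add_right_mono mgfK_le)
      finally show ?thesis .
    qed
    have "mgfK (real n) A * ennreal_exp (J t (S m)) \<le> mgf' t \<mu>" for n :: nat
    proof (rule ennreal_le_epsilon)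
      fix e :: real assume e: "0 < e"
      \<comment> \<open>Makes \<open>n * c / k\<close> at most \<open>e\<close>; the added 1 keeps
        \<open>k\<close> positive when \<open>n * c\<close> is 0.\<close>
      define k where "k = (real n * c + 1) / e"
      have k: "0 < k" using e c(1) by (simp add: k_def add_nonneg_pos)
      have "real n * c / k \<le> (real n * c + 1) / k" using k by (intro divide_right_mono) auto
      also have "\<dots> = e" using k e by (auto simp: k_def)
      finally have "mgf' t \<mu> + ennreal (real n * c / k) \<le> mgf' t \<mu> + ennreal e"
        by (intro add_left_mono ennreal_leI)
      then show "mgfK (real n) A * ennreal_exp (J t (S m)) \<le> mgf' t \<mu> + ennreal e"
        by (rule order_trans[OF step[OF k]])
    qed
    \<comment> \<open>The truncation of \<open>A\<close> is lifted only now, after \<open>k\<close>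
      has disappeared, since the error term grows with \<open>n\<close>. The moment of
      \<open>A\<close> may be infinite here.\<close>
    then have "(SUP n. mgfK (real n) A * ennreal_exp (J t (S m))) \<le> mgf' t \<mu>"
      by (rule SUP_least)
    also have "(SUP n. mgfK (real n) A * ennreal_exp (J t (S m))) = mgf' t A * ennreal_exp (J t (S m))"
      by (simp add: SUP_mult_right_ennreal[symmetric] SUP_mgfK A(1))
    also have "\<dots> = ennreal_exp (ennreal (a * t\<^sup>2 / 2) + J t (L \<union> S m))"
      by (simp add: A(3) ennreal_exp_add[symmetric] J_add[symmetric] add.assoc)
    finally show ?thesis .
  qed
  have "ennreal_exp (SUP m. ennreal (a * t\<^sup>2 / 2) + J t (L \<union> S m)) \<le> mgf' t \<mu>"
    by (rule ennreal_exp_SUP_le[OF lower])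
  also have "(SUP m. ennreal (a * t\<^sup>2 / 2) + J t (L \<union> S m)) = ennreal (a * t\<^sup>2 / 2) + J t UNIV"
    unfolding J_total[symmetric] by (simp add: ennreal_SUP_add_right)
  finally have "mgf' t \<mu> = ennreal_exp (ennreal (a * t\<^sup>2 / 2) + J t UNIV)"
    using upper by (rule antisym[rotated])
  then show ?thesis by (simp add: mgf'_def J_def)
qed

end

section \<open>Centering, reflection and test functions\<close>

text \<open>One criterion for the two derivatives compared in \<open>char_centered\<close>: that of
  the exponent and that of the characteristic function.\<close>

lemma has_vector_derivative_at_0_quadratic:
  fixes f :: "real \<Rightarrow> 'a::real_normed_vector"
  assumes le: "\<And>t. norm (f t - f 0 - t *\<^sub>R c) \<le> C * t\<^sup>2"
  shows "(f has_vector_derivative c) (at 0)"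
  unfolding has_vector_derivative_def has_derivative_at
proof (intro conjI bounded_linear_scaleR_left)
  show "(\<lambda>h. norm (f (0 + h) - f 0 - h *\<^sub>R c) / norm h) \<midarrow>0\<rightarrow> 0"
  proof (rule Lim_null_comparison[where g = "\<lambda>h. C * \<bar>h\<bar>"])
    show "\<forall>\<^sub>F h in at 0. norm (norm (f (0 + h) - f 0 - h *\<^sub>R c) / norm h) \<le> C * \<bar>h\<bar>"
      unfolding eventually_at_filter
    proof (intro always_eventually allI impI)
      fix h :: real assume "h \<noteq> 0"
      then show "norm (norm (f (0 + h) - f 0 - h *\<^sub>R c) / norm h) \<le> C * \<bar>h\<bar>"
        using le[of h] by (simp add: divide_le_eq power2_eq_square mult.assoc abs_mult_self_eq)
    qed
    show "(\<lambda>h. C * \<bar>h\<bar>) \<midarrow>0\<rightarrow> 0" by (auto intro!: tendsto_eq_intros)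
  qed
qed

section \<open>Centering removes the drift\<close>

context canonical_law
begin

text \<open>Both sides of the Levy-Khintchine formula are differentiable at \<open>0\<close>, so a centered law
  forces the drift to compensate the large jumps.\<close>

lemma char_centered:
  assumes \<mu>: "real_distribution \<mu>" and sq: "integrable \<mu> (\<lambda>x. x\<^sup>2)" and mean: "(\<integral>x. x \<partial>\<mu>) = 0"
    and char_\<mu>: "\<And>t. char \<mu> t = exp (\<i> * of_real (b * t) - of_real (a * t\<^sup>2 / 2) +
          (CLINT x|\<nu>. iexp (t * x) - 1 - \<i> * of_real (t * x * indicator {-1..1} x)))"
  shows "char \<mu> s = exp (- of_real (a * s\<^sup>2 / 2) + (CLINT x|\<nu>. iexp (s * x) - 1 - \<i> * of_real (s * x)))"
proof -
  interpret \<mu>: real_distribution \<mu> by fact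
  \<comment> \<open>\<open>d\<close> is the mean of the jumps outside [-1, 1], finite since
    \<open>\<bar>x\<bar> \<le> x\<^sup>2\<close> there. Moving it into the drift turns the truncated
    compensation into the full one, with total drift \<beta>.\<close>
  define d where "d = (\<integral>x. x * indicator (- {-1..1}) x \<partial>\<nu>)"
  define \<eta> where "\<eta> t = (CLINT x|\<nu>. iexp (t * x) - 1 - \<i> * of_real (t * x))" for t
  define \<beta> where "\<beta> = b + d"
  have "norm (x * indicator (- {-1..1}) x) \<le> 1 * x\<^sup>2" for x :: real
  proof (cases "x \<in> {-1..1}")
    case False
    then have "1 * \<bar>x\<bar> \<le> \<bar>x\<bar> * \<bar>x\<bar>" by (intro mult_right_mono) auto
    then show ?thesis using False by (simp add: power2_eq_square)
  qed simp
  then have d_int: "integrable \<nu> (\<lambda>x. x * indicator (- {-1..1}) x)"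
    by (intro integrable_\<nu>_bounded_square[where C=1]) auto
  have trunc: "(CLINT x|\<nu>. iexp (t * x) - 1 - \<i> * of_real (t * x * indicator {-1..1} x)) = \<eta> t + \<i> * of_real (t * d)" for t
  proof -
    have "(CLINT x|\<nu>. iexp (t * x) - 1 - \<i> * of_real (t * x * indicator {-1..1} x)) =
        (CLINT x|\<nu>. (iexp (t * x) - 1 - \<i> * of_real (t * x)) + \<i> * of_real (t * (x * indicator (- {-1..1}) x)))"
      by (intro Bochner_Integration.integral_cong) (auto split: split_indicator)
    also have "\<dots> = \<eta> t + (CLINT x|\<nu>. \<i> * of_real (t * (x * indicator (- {-1..1}) x)))"
      unfolding \<eta>_def using d_int
      by (intro Bochner_Integration.integral_add integrable_iexp_remainder integrable_mult_right integrable_of_real) auto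
    also have "(CLINT x|\<nu>. \<i> * of_real (t * (x * indicator (- {-1..1}) x))) = \<i> * of_real (t * d)"
      unfolding d_def integral_mult_right_zero integral_complex_of_real ..
    finally show ?thesis .
  qed
  define w where "w t = \<i> * of_real (\<beta> * t) - of_real (a * t\<^sup>2 / 2) + \<eta> t" for t
  have char_w: "char \<mu> t = exp (w t)" for t
    unfolding char_\<mu> trunc w_def \<beta>_def by (simp add: algebra_simps)
  define C where "C = a / 2 + (\<integral>x. 1 / 2 * x\<^sup>2 \<partial>\<nu>)"
  have \<eta>_le: "norm (\<eta> t) \<le> t\<^sup>2 * (\<integral>x. 1 / 2 * x\<^sup>2 \<partial>\<nu>)" for t
  proof -
    have sq: "integrable \<nu> (\<lambda>x. x\<^sup>2)" by (rule integrable_\<nu>_bounded_square[where C=1]) auto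
    have "norm (\<eta> t) \<le> (\<integral>x. norm (iexp (t * x) - 1 - \<i> * of_real (t * x)) \<partial>\<nu>)"
      unfolding \<eta>_def by (rule integral_norm_bound)
    also have "\<dots> \<le> (\<integral>x. t\<^sup>2 * (1 / 2 * x\<^sup>2) \<partial>\<nu>)"
    proof (rule integral_mono[OF integrable_norm[OF integrable_iexp_remainder]])
      show "integrable \<nu> (\<lambda>x. t\<^sup>2 * (1 / 2 * x\<^sup>2))" using sq by simp
      show "norm (iexp (t * x) - 1 - \<i> * of_real (t * x)) \<le> t\<^sup>2 * (1 / 2 * x\<^sup>2)" for x
        using iexp_remainder_bound[of t x] by simp
    qed
    also have "\<dots> = t\<^sup>2 * (\<integral>x. 1 / 2 * x\<^sup>2 \<partial>\<nu>)" by (rule integral_mult_right_zero)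
    finally show ?thesis .
  qed
  have w0: "w 0 = 0" by (simp add: w_def \<eta>_def)
  have "(w has_vector_derivative \<i> * of_real \<beta>) (at 0)"
  proof (rule has_vector_derivative_at_0_quadratic[where C = C])
    fix t
    have "norm (w t - w 0 - t *\<^sub>R (\<i> * of_real \<beta>)) = norm (\<eta> t - of_real (a * t\<^sup>2 / 2))"
      unfolding w0 by (simp add: w_def scaleR_conv_of_real algebra_simps)
    also have "\<dots> \<le> norm (\<eta> t) + norm (complex_of_real (a * t\<^sup>2 / 2))" by (rule norm_triangle_ineq4)
    also have "\<dots> \<le> C * t\<^sup>2"
      using \<eta>_le[of t] a_nonneg unfolding norm_of_real C_def by (simp add: algebra_simps)
    finally show "norm (w t - w 0 - t *\<^sub>R (\<i> * of_real \<beta>)) \<le> C * t\<^sup>2" .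
  qed
  moreover have "(exp has_field_derivative 1) (at (w 0))"
    using DERIV_exp[of "w 0"] w0 by simp
  \<comment> \<open>Differentiating \<open>exp \<circ> w\<close>, rather than a logarithm of the
    characteristic function, avoids the choice of a branch.\<close>
  ultimately have "((exp \<circ> w) has_vector_derivative \<i> * of_real \<beta> * 1) (at 0)"
    by (rule field_vector_diff_chain_at)
  \<comment> \<open>The mean is zero, so no linear term is present. The constant
    \<open>3 / 2\<close> is 1 from the second-order Taylor error plus \<open>1 / 2\<close> from the
    quadratic term.\<close>
  moreover have "((exp \<circ> w) has_vector_derivative 0) (at 0)"
  proof (rule has_vector_derivative_at_0_quadratic[where C = "3 / 2 * (\<integral>x. x\<^sup>2 \<partial>\<mu>)"])
    fix t
    have "integrable \<mu> (\<lambda>x. x)"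
      using sq abs_le_one_plus_square by (intro Bochner_Integration.integrable_bound[of \<mu> "\<lambda>x. 1 + x\<^sup>2" "\<lambda>x. x"]) auto
    then have int: "integrable \<mu> (\<lambda>x. x ^ k)" if "k \<le> 2" for k
      using that sq by (auto simp: le_Suc_eq numeral_2_eq_2)
    define E where "E = (\<integral>x. x\<^sup>2 \<partial>\<mu>)"
    have E: "0 \<le> E" unfolding E_def by (intro Bochner_Integration.integral_nonneg) simp
    have "norm (char \<mu> t - (1 - of_real (t\<^sup>2 * E / 2))) \<le> t\<^sup>2 * E"
    proof -
      have "(\<Sum>k\<le>2. ((\<i> * complex_of_real t) ^ k / fact k) * \<mu>.expectation (\<lambda>x. x ^ k)) = 1 - of_real (t\<^sup>2 * E / 2)"
        using mean \<mu>.prob_space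
        by (simp add: numeral_2_eq_2 E_def power_mult_distrib)
      then show ?thesis using \<mu>.char_approx1[of 2 t, OF int] by (simp add: E_def)
    qed
    then have "norm ((char \<mu> t - (1 - of_real (t\<^sup>2 * E / 2))) - of_real (t\<^sup>2 * E / 2)) \<le> t\<^sup>2 * E + t\<^sup>2 * E / 2"
      by (rule order_trans[OF norm_triangle_ineq4 add_mono]) (subst norm_of_real, use E in simp)
    then show "norm ((exp \<circ> w) t - (exp \<circ> w) 0 - t *\<^sub>R 0) \<le> 3 / 2 * (\<integral>x. x\<^sup>2 \<partial>\<mu>) * t\<^sup>2"
      by (simp add: w0 char_w[symmetric] E_def[symmetric] algebra_simps)
  qed
  ultimately have "\<i> * of_real \<beta> * 1 = (0 :: complex)"
    by (rule vector_derivative_unique_at)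
  then have "\<beta> = 0" by simp
  then show ?thesis by (simp add: char_w w_def \<eta>_def)
qed

section \<open>The negative half-line by reflection\<close>

lemma set_integrable_neg:
  assumes "r < 0" shows "set_integrable \<nu> {..<r} (\<lambda>x. r - x)"
proof -
  interpret U: canonical_law V a "distr \<nu> borel uminus" "distr P borel uminus"
    by (rule canonical_law_uminus)
  have "integrable \<nu> (\<lambda>x. indicator {-r<..} (- x) *\<^sub>R (- x - - r))"
    using U.set_integrable_pos[of "- r"] assms unfolding set_integrable_def
    by (simp add: integrable_distr_eq)
  also have "(\<lambda>x. indicator {-r<..} (- x) *\<^sub>R (- x - - r)) = (\<lambda>x. indicator {..<r} x *\<^sub>R (r - x))"
    by (auto split: split_indicator)
  finally show ?thesis unfolding set_integrable_def .
qed

lemma continuous_on_remainder_density_neg: "continuous_on {..<0} (remainder_density V \<nu>)"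
proof -
  interpret U: canonical_law V a "distr \<nu> borel uminus" "distr P borel uminus"
    by (rule canonical_law_uminus)
  have "continuous_on {..<0} (\<lambda>r. remainder_density V (distr \<nu> borel uminus) (- r))"
    by (rule continuous_on_compose2[OF U.continuous_on_remainder_density_pos]) (auto intro!: continuous_intros)
  then show ?thesis by (simp add: remainder_density_uminus)
qed

lemma emeasure_remainder_law_neg:
  assumes [measurable]: "A \<in> sets borel" and A: "A \<subseteq> {..<0}"
  shows "emeasure (remainder_law P) A = (\<integral>\<^sup>+r\<in>A. ennreal (remainder_density V \<nu> r) \<partial>lborel)"
proof -
  interpret U: canonical_law V a "distr \<nu> borel uminus" "distr P borel uminus"
    by (rule canonical_law_uminus)
  have [measurable]: "uminus -` A \<in> sets (borel :: real measure)"
    using measurable_sets[of uminus borel borel A] by simp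
  \<comment> \<open>The change of variables asks for a measurable integrand; on the negative
    half-line measurability comes from continuity.\<close>
  have meas: "(\<lambda>r. ennreal (remainder_density V \<nu> r) * indicator A r) \<in> borel_measurable borel"
  proof -
    have "(\<lambda>r. indicator {..<0} r *\<^sub>R remainder_density V \<nu> r) \<in> borel_measurable borel"
      by (intro borel_measurable_continuous_on_indicator continuous_on_remainder_density_neg) simp
    then have "(\<lambda>r. ennreal (indicator {..<0} r *\<^sub>R remainder_density V \<nu> r) * indicator A r) \<in> borel_measurable borel"
      by measurable
    also have "(\<lambda>r. ennreal (indicator {..<0} r *\<^sub>R remainder_density V \<nu> r) * indicator A r) =
        (\<lambda>r. ennreal (remainder_density V \<nu> r) * indicator A r)"
      using A by (auto simp: fun_eq_iff indicator_def)
    finally show ?thesis .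
  qed
  have "emeasure (remainder_law P) A = emeasure (distr (remainder_law P) borel uminus) (uminus -` A)"
    by (subst emeasure_distr)
       (auto simp: vimage_def sets_eq_imp_space_eq[OF sets_remainder_law])
  also have "\<dots> = (\<integral>\<^sup>+r. ennreal (remainder_density V \<nu> (- r)) * indicator A (- r) \<partial>lborel)"
    unfolding remainder_law_uminus[symmetric] using A
    by (subst U.emeasure_remainder_law_pos) (auto simp: remainder_density_uminus indicator_def)
  also have "\<dots> = (\<integral>\<^sup>+r. ennreal (remainder_density V \<nu> r) * indicator A r \<partial>lborel)"
    using nn_integral_real_affine[OF meas, of "-1" 0] by simp
  finally show ?thesis .
qed

lemma integral_test_function_neg:
  fixes \<phi> \<phi>' \<phi>'' :: "real \<Rightarrow> real"
  assumes \<phi>: "\<And>x. (\<phi> has_field_derivative \<phi>' x) (at x)"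
    and \<phi>': "\<And>x. (\<phi>' has_field_derivative \<phi>'' x) (at x)"
    and \<phi>'': "continuous_on UNIV \<phi>''"
    and d: "d < 0" and supp: "\<And>x. x \<notin> {c..d} \<Longrightarrow> \<phi> x = 0"
  shows "(\<integral>x. \<phi> x \<partial>\<nu>) = V / 2 * (\<integral>r. remainder_density V \<nu> r * \<phi>'' r \<partial>lborel)"
proof -
  interpret U: canonical_law V a "distr \<nu> borel uminus" "distr P borel uminus"
    by (rule canonical_law_uminus)
  have meas[measurable]: "\<phi> \<in> borel_measurable borel"
    using \<phi> by (auto intro!: borel_measurable_continuous_onI continuous_at_imp_continuous_on DERIV_isCont)
  have refl: "((\<lambda>x. f (- x)) has_field_derivative - f' (- x)) (at x)"
    if "\<And>x. (f has_field_derivative f' x) (at x)" for f f' :: "real \<Rightarrow> real" and x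
    using DERIV_chain2[where f = f and g = uminus, OF that DERIV_minus[OF DERIV_ident]] by simp
  have "(\<integral>x. \<phi> (- x) \<partial>distr \<nu> borel uminus) =
      V / 2 * (\<integral>r. remainder_density V (distr \<nu> borel uminus) r * \<phi>'' (- r) \<partial>lborel)"
  proof (rule U.integral_test_function_pos[where c = "- d" and d = "- c"])
    show "((\<lambda>x. \<phi> (- x)) has_real_derivative - \<phi>' (- x)) (at x)" for x by (rule refl[OF \<phi>])
    show "((\<lambda>x. - \<phi>' (- x)) has_real_derivative \<phi>'' (- x)) (at x)" for x
      using DERIV_minus[OF refl[OF \<phi>', of x]] by simp
    show "continuous_on UNIV (\<lambda>x. \<phi>'' (- x))"
      by (rule continuous_on_compose2[OF \<phi>'']) (auto intro!: continuous_intros)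
  qed (use d supp in auto)
  also have "(\<integral>x. \<phi> (- x) \<partial>distr \<nu> borel uminus) = (\<integral>x. \<phi> x \<partial>\<nu>)"
    by (subst integral_distr) auto
  also have "(\<integral>r. remainder_density V (distr \<nu> borel uminus) r * \<phi>'' (- r) \<partial>lborel) =
      (\<integral>r. remainder_density V \<nu> r * \<phi>'' r \<partial>lborel)"
    using lborel_integral_real_affine[of "-1" "\<lambda>r. remainder_density V \<nu> r * \<phi>'' r" 0]
    by (simp add: remainder_density_uminus)
  finally show ?thesis .
qed

text \<open>The two minus signs of \<open>dist_deriv\<close> cancel, which leaves the integral of
  the density against the second derivative of \<phi>.\<close>

lemma dist_of_measure_eq_dist_deriv:
  assumes S: "S \<in> {{0<..}, {..<0}}" and \<phi>: "\<phi> \<in> test_functions S"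
  shows "dist_of_measure \<nu> \<phi> = V / 2 * dist_deriv (dist_deriv (dist_of_fun (remainder_density V \<nu>))) \<phi>"
proof -
  have diff: "(deriv ^^ n) \<phi> field_differentiable at x" for n x
    using \<phi> by (simp add: test_functions_def)
  obtain K where K: "compact K" "K \<subseteq> S" "\<And>x. x \<notin> K \<Longrightarrow> \<phi> x = 0"
    using \<phi> unfolding test_functions_def by blast
  have d1: "(\<phi> has_field_derivative deriv \<phi> x) (at x)" for x
    using diff[of 0 x] by (simp add: field_differentiable_derivI)
  have d2: "(deriv \<phi> has_field_derivative deriv (deriv \<phi>) x) (at x)" for x
    using diff[of 1 x] by (simp add: field_differentiable_derivI)
  have cont: "continuous_on UNIV (deriv (deriv \<phi>))"
    using diff[of 2] by (intro continuous_at_imp_continuous_on ballI field_differentiable_imp_continuous_at)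
      (simp add: numeral_2_eq_2)
  \<comment> \<open>The least and greatest points of \<open>K\<close> lie in \<open>S\<close>, so
    the interval between them stays away from the origin, which is the gap that the half-line lemmas
    ask for. For empty \<open>K\<close> any single point of \<open>S\<close> will do.\<close>
  obtain c d where K_sub: "K \<subseteq> {c..d}" and cd: "{c, d} \<subseteq> S"
  proof (cases "K = {}")
    case True
    obtain z where "z \<in> S" using S by (metis emptyE greaterThan_non_empty insertE lessThan_non_empty ex_in_conv)
    then show ?thesis using True that[of z z] by auto
  next
    case False
    obtain c where "c \<in> K" "\<And>x. x \<in> K \<Longrightarrow> c \<le> x" using compact_attains_inf[OF K(1) False] by blast
    moreover obtain d where "d \<in> K" "\<And>x. x \<in> K \<Longrightarrow> x \<le> d" using compact_attains_sup[OF K(1) False] by blast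
    ultimately show ?thesis using K(2) by (intro that[of c d]) auto
  qed
  have supp: "\<phi> x = 0" if "x \<notin> {c..d}" for x
    using K(3) K_sub that by blast
  have "(\<integral>x. \<phi> x \<partial>\<nu>) = V / 2 * (\<integral>r. remainder_density V \<nu> r * deriv (deriv \<phi>) r \<partial>lborel)"
    using S
  proof (elim insertE emptyE)
    assume "S = {0<..}"
    then show ?thesis using cd supp by (intro integral_test_function_pos[OF d1 d2 cont, of c d]) auto
  next
    assume "S = {..<0}"
    then show ?thesis using cd supp by (intro integral_test_function_neg[OF d1 d2 cont, of d c]) auto
  qed
  then show ?thesis by (simp add: dist_of_measure_def dist_deriv_def dist_of_fun_def)
qed

end

text \<open>With the drift eliminated, \<open>a\<close> and \<nu> alone fix the characteristic
  function. This serves both the exponential moments and the uniqueness of the law of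
  \<open>X\<close>.\<close>

lemma centered_infinitely_divisible_rvD:
  assumes X: "centered_infinitely_divisible_rv M X V a \<nu>" and law: "canonical_law V a \<nu> P"
  shows "real_distribution (distr M borel X)"
    "char (distr M borel X) s =
      exp (- of_real (a * s\<^sup>2 / 2) + (CLINT x|\<nu>. iexp (s * x) - 1 - \<i> * of_real (s * x)))"
proof -
  interpret canonical_law V a \<nu> P by fact
  have M: "prob_space M" and [measurable]: "X \<in> borel_measurable M"
    and sq: "integrable M (\<lambda>\<omega>. (X \<omega>)\<^sup>2)" and mean: "prob_space.expectation M X = 0"
    using X by (auto simp: centered_infinitely_divisible_rv_def)
  show dist: "real_distribution (distr M borel X)"
    using M by (rule prob_space.real_distribution_distr) measurable
  obtain b where "\<And>t. char (distr M borel X) t = exp (\<i> * of_real (b * t) - of_real (a * t\<^sup>2 / 2) +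
          (CLINT x|\<nu>. iexp (t * x) - 1 - \<i> * of_real (t * x * indicator {-1..1} x)))"
    using X unfolding centered_infinitely_divisible_rv_def has_gaussian_variance_and_levy_measure_def by blast
  then show "char (distr M borel X) s =
      exp (- of_real (a * s\<^sup>2 / 2) + (CLINT x|\<nu>. iexp (s * x) - 1 - \<i> * of_real (s * x)))"
    using dist sq mean by (intro char_centered[of _ b]) (auto simp: integrable_distr_eq integral_distr)
qed

theorem theorem2p1:
  fixes M :: "'a measure" and X :: "'a \<Rightarrow> real"
    and N :: "'b measure" and R :: "'b \<Rightarrow> real"
    and V a :: real and \<nu> :: "real measure"
    and M' :: "'c measure" and X' :: "'c \<Rightarrow> real"
    and N' :: "'d measure" and R' :: "'d \<Rightarrow> real"
    and V' a' :: real and \<nu>' :: "real measure"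
  assumes X: "centered_infinitely_divisible_rv M X V a \<nu>"
    and R: "signed_canonical_remainder N R V a \<nu>"
  shows
    "(\<forall>t. cgf M X t = ereal (V * t\<^sup>2 / 2) * enn2ereal (mgf N R t)) \<and>
     measure (distr N borel R) {0} = a / V \<and>
     (\<forall>r>0. set_integrable \<nu> {r<..} (\<lambda>x. x - r)) \<and>
     (\<forall>r<0. set_integrable \<nu> {..<r} (\<lambda>x. r - x)) \<and>
     continuous_on {0<..} (remainder_density V \<nu>) \<and>
     continuous_on {..<0} (remainder_density V \<nu>) \<and>
     (\<forall>A\<in>sets borel. A \<subseteq> {0<..} \<or> A \<subseteq> {..<0} \<longrightarrow>
        emeasure (distr N borel R) A =
          (\<integral>\<^sup>+r\<in>A. ennreal (remainder_density V \<nu> r) \<partial>lborel)) \<and>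
     (centered_infinitely_divisible_rv M' X' V' a' \<nu>' \<and>
      signed_canonical_remainder N' R' V' a' \<nu>' \<and>
      V' = V \<and> distr N' borel R' = distr N borel R \<longrightarrow>
        a' = a \<and> \<nu>' = \<nu> \<and> distr M' borel X' = distr M borel X) \<and>
     (\<forall>S\<in>{{0<..}, {..<0}}. \<forall>\<phi>\<in>test_functions S.
        dist_of_measure \<nu> \<phi> =
          V / 2 * dist_deriv (dist_deriv (dist_of_fun (remainder_density V \<nu>))) \<phi>)"
proof -
  have V: "0 < V" and a: "0 \<le> a" and \<nu>: "levy_measure \<nu>"
    using X unfolding centered_infinitely_divisible_rv_def has_gaussian_variance_and_levy_measure_def by auto
  define P where "P = scale_measure (ennreal (1 / V)) (canonical_measure a \<nu>)"
  note R_law = signed_canonical_remainderD[OF R V a \<nu>, folded P_def]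
  interpret canonical_law V a \<nu> P by (rule R_law(1))
  have X_meas[measurable]: "X \<in> borel_measurable M" using X by (simp add: centered_infinitely_divisible_rv_def)
  have R_meas[measurable]: "R \<in> borel_measurable N" by (rule R_law(2))
  note X_law = centered_infinitely_divisible_rvD[OF X R_law(1)]
  have cgf_eq: "cgf M X t = ereal (V * t\<^sup>2 / 2) * enn2ereal (mgf N R t)" for t
  proof -
    have "mgf N R t = (\<integral>\<^sup>+r. ennreal (exp (t * r)) \<partial>remainder_law P)"
      unfolding mgf_def R_law(3)[symmetric] by (simp add: nn_integral_distr)
    then have "ennreal (V * t\<^sup>2 / 2) * mgf N R t =
        ennreal (a * t\<^sup>2 / 2) + (\<integral>\<^sup>+x. ennreal (exp (t * x) - 1 - t * x) \<partial>\<nu>)"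
      by (simp only: mgf_remainder_law)
    moreover have "mgf M X t = (\<integral>\<^sup>+x. ennreal (exp (t * x)) \<partial>distr M borel X)"
      unfolding mgf_def by (simp add: nn_integral_distr)
    ultimately have "mgf M X t = ennreal_exp (ennreal (V * t\<^sup>2 / 2) * mgf N R t)"
      using mgf_infinitely_divisible[OF X_law] by simp
    then show ?thesis
      using V by (simp add: cgf_def ln_ennreal_exp times_ennreal.rep_eq)
  qed
  have unique: "a' = a \<and> \<nu>' = \<nu> \<and> distr M' borel X' = distr M borel X"
    if X': "centered_infinitely_divisible_rv M' X' V' a' \<nu>'"
      and R': "signed_canonical_remainder N' R' V' a' \<nu>'"
      and V': "V' = V" and eq: "distr N' borel R' = distr N borel R"
  proof -
    have a': "0 \<le> a'" and \<nu>': "levy_measure \<nu>'"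
      using X' unfolding centered_infinitely_divisible_rv_def has_gaussian_variance_and_levy_measure_def by auto
    define P' where "P' = scale_measure (ennreal (1 / V)) (canonical_measure a' \<nu>')"
    note R'_law = signed_canonical_remainderD[OF R'[unfolded V'] V a' \<nu>', folded P'_def]
    have "remainder_law P' = remainder_law P"
      using eq R_law(3) R'_law(3) by simp
    from canonical_law_unique[OF R_law(1) R'_law(1) this] have a\<nu>: "a' = a" "\<nu>' = \<nu>" .
    \<comment> \<open>Once \<open>a'\<close> and \<open>\<nu>'\<close> are identified,
      \<open>X'\<close> obeys the same drift-free formula as \<open>X\<close>, so their
      characteristic functions agree.\<close>
    note X'_law = centered_infinitely_divisible_rvD[OF X'[unfolded V' a\<nu>] R_law(1)]
    have "distr M' borel X' = distr M borel X"
      using X_law X'_law by (intro Levy_uniqueness) auto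
    then show ?thesis using a\<nu> by simp
  qed
  have "emeasure (distr N borel R) A = (\<integral>\<^sup>+r\<in>A. ennreal (remainder_density V \<nu> r) \<partial>lborel)"
    if "A \<in> sets borel" "A \<subseteq> {0<..} \<or> A \<subseteq> {..<0}" for A
    using that emeasure_remainder_law_pos emeasure_remainder_law_neg unfolding R_law(3) by blast
  then show ?thesis
    using cgf_eq measure_remainder_law_zero set_integrable_pos set_integrable_neg
      continuous_on_remainder_density_pos continuous_on_remainder_density_neg unique
      dist_of_measure_eq_dist_deriv
    unfolding R_law(3) by (intro conjI) blast+
qed

end
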